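(* Let $\ell\ge r\ge 3$ be integers and $\binom{\ell}{2}-1\leq k<\frac{\ell^2-1}{2}$. For every $C>0$ there exist $C'>0$ and $n_0$ such that the following holds for all $n\ge n_0$. Suppose $\mathcal{H}_1,\dots,\mathcal{H}_k$ are $r$-graphs on a common $n$-vertex set $V$ containing no rainbow copy of $K_\ell^{(r)+}$, with $e(\mathcal{H}_1)\geq \dots\geq e(\mathcal{H}_k)$. If $\sum_{i\in[k]}e(\mathcal{H}_i)\geq \left(\binom{\ell}{2}-1\right)\binom{n}{r}-Cn^{r-1}$, then one can delete a set of at most $C'n^{r-1}$ hyperedges from $\bigcup_{i}\mathcal{H}_i$ such that every remaining hyperedge is contained in exactly the hypergraphs $\mathcal{H}_1,\dots,\mathcal{H}_{\binom{\ell}{2}-1}$ (and in no other $\mathcal{H}_i$).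
   Context: An $r$-graph is an $r$-uniform hypergraph. $K_\ell^{(r)+}$ is the $r$-expansion of the complete graph $K_\ell$: each edge of $K_\ell$ is enlarged by $r-2$ new vertices, all new vertices distinct from each other and from the $\ell$ original vertices. $r$-graphs $\mathcal{H}_1,\dots,\mathcal{H}_k$ on a common vertex set contain a rainbow copy of $\mathcal{F}$ if their union contains a copy of $\mathcal{F}$ whose hyperedges lie in pairwise distinct $\mathcal{H}_i$'s. *)

theory Defs
  imports Complex_Main "HOL-Library.Ramsey"
begin

text \<open>
  A hypergraph is a pair of a vertex set and an edge set. An r-graph on a given vertex set \<open>V\<close>
  is just an edge set \<open>E \<subseteq> [V]\<^bsup>r\<^esup>\<close>, where \<open>[V]\<^bsup>r\<^esup>\<close> (\<open>nsets V r\<close>) is the set of r-element subsets of \<open>V\<close>.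
\<close>

type_synonym 'a hypergraph = "'a set \<times> 'a set set"

definition complete_graph :: "nat \<Rightarrow> nat hypergraph" where
  "complete_graph l = ({..<l}, nsets {..<l} 2)"

text \<open>
  In the r-expansion the original vertices are tagged \<open>Inl\<close>; the \<open>r - 2\<close> new vertices
  enlarging an edge \<open>e\<close> are \<open>Inr (e, j)\<close> for \<open>j < r - 2\<close>. The truncated subtraction is
  meaningful only for \<open>r \<ge> 2\<close>.
\<close>

definition expand_edge :: "nat \<Rightarrow> 'a set \<Rightarrow> ('a + 'a set \<times> nat) set" where
  "expand_edge r e = Inl ` e \<union> Inr ` ({e} \<times> {..<r - 2})"

definition expansion :: "nat \<Rightarrow> 'a hypergraph \<Rightarrow> ('a + 'a set \<times> nat) hypergraph" where
  "expansion r G =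
     (Inl ` fst G \<union> Inr ` (snd G \<times> {..<r - 2}), expand_edge r ` snd G)"

text \<open>
  A rainbow copy of \<open>F\<close> in the family \<open>H i\<close>, \<open>i \<in> I\<close>, on vertex set \<open>V\<close>: an embedding \<open>\<phi>\<close> of the
  vertices of \<open>F\<close> into \<open>V\<close>, together with an injective assignment \<open>c\<close> of an index to each edge.
\<close>

definition contains_rainbow_copy ::
  "'v set \<Rightarrow> 'i set \<Rightarrow> ('i \<Rightarrow> 'v set set) \<Rightarrow> 'a hypergraph \<Rightarrow> bool" where
  "contains_rainbow_copy V I H F \<longleftrightarrow>
     (\<exists>\<phi> c. inj_on \<phi> (fst F) \<and> \<phi> ` fst F \<subseteq> V \<and>
            inj_on c (snd F) \<and> c ` snd F \<subseteq> I \<and>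
            (\<forall>e\<in>snd F. \<phi> ` e \<in> H (c e)))"

end

theory Submission
  imports Defs
begin

text \<open>
  Give every pair \<open>p\<close> the set \<open>S p\<close> of those \<open>i\<close> for which \<open>p\<close> lies in so many edges of \<open>H i\<close> that a pair
  can be enlarged to an edge avoiding any bounded set of vertices. A rainbow \<open>K\<^sub>l\<close> with respect to \<open>S\<close>
  would extend greedily to a rainbow expansion, so there is none; and since all but \<open>O(n\<^sup>r\<^sup>-\<^sup>1)\<close>
  edges of \<open>H i\<close> have only pairs with \<open>i \<in> S p\<close>, the weights \<open>card (S p)\<close> add up to at least
  \<open>m (n choose 2) - O(n)\<close>, where \<open>m = (l choose 2) - 1\<close>.

  After passing to a vertex set \<open>U\<close> of large minimum degree, any short sequence of vertices can be
  extended by a vertex joined to the \<open>b\<close> previous ones with total weight at least \<open>m b\<close>. The bound on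
  \<open>k\<close> forces the \<open>l\<close> vertices obtained in this way to span fewer than \<open>t\<close> pairs of weight less than
  \<open>t\<close>, for each \<open>t \<le> m\<close>. Distinct representatives can then be chosen greedily unless all the sets
  are one and the same set of size \<open>m\<close>. Hence inside \<open>U\<close> no weight exceeds \<open>m\<close> and all pairs of weight
  \<open>m\<close> carry the same set \<open>I\<close>, while all other pairs number only \<open>O(n)\<close>.
\<close>

section \<open>Systems of distinct representatives\<close>

text \<open>The hypothesis with \<open>t = card E\<close> yields an element whose set has at least
  \<open>card E\<close> members. Such an element can wait until last: whatever the other elements
  use, one of its values is still free. Removing it preserves the hypothesis for the smaller
  \<open>t\<close>.\<close>

lemma greedy_sdr:
  fixes S :: "'e \<Rightarrow> 'c set"
  assumes "finite E" and "\<And>e. e \<in> E \<Longrightarrow> finite (S e)"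
    and "\<And>t. 1 \<le> t \<Longrightarrow> t \<le> card E \<Longrightarrow> card {e\<in>E. card (S e) < t} < t"
  shows "\<exists>c. inj_on c E \<and> (\<forall>e\<in>E. c e \<in> S e)"
  using assms
proof (induction "card E" arbitrary: E)
  case 0
  then show ?case by auto
next
  case (Suc N)
  have "card {e\<in>E. card (S e) < card E} < card E"
    using Suc.prems(3)[of "card E"] Suc.hyps(2) by simp
  then have "{e\<in>E. card (S e) < card E} \<noteq> E" by auto
  then obtain x where x: "x \<in> E" "card (S x) \<ge> card E" by (auto simp: not_less[symmetric])
  have "\<exists>c. inj_on c (E - {x}) \<and> (\<forall>e\<in>E - {x}. c e \<in> S e)"
  proof (rule Suc.hyps(1))
    show "N = card (E - {x})" using Suc.hyps(2) x Suc.prems(1) by simp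
    show "card {e \<in> E - {x}. card (S e) < t} < t" if "1 \<le> t" "t \<le> card (E - {x})" for t
    proof -
      have "t \<le> card E" using that(2) card_mono[OF Suc.prems(1), of "E - {x}"] by auto
      moreover have "card {e \<in> E - {x}. card (S e) < t} \<le> card {e \<in> E. card (S e) < t}"
        using Suc.prems(1) by (intro card_mono) auto
      ultimately show ?thesis using Suc.prems(3)[OF that(1)] by linarith
    qed
  qed (use Suc.prems in auto)
  then obtain c where c: "inj_on c (E - {x})" "\<forall>e\<in>E - {x}. c e \<in> S e" by blast
  have "card (c ` (E - {x})) < card E"
    using card_image_le[of "E - {x}" c] Suc.prems(1) Suc.hyps(2) x by simp
  then have "\<not> S x \<subseteq> c ` (E - {x})"
    using card_mono[of "c ` (E - {x})" "S x"] Suc.prems(1) x(2) by force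
  then obtain y where y: "y \<in> S x" "y \<notin> c ` (E - {x})" by blast
  have "inj_on (c(x := y)) E"
    using c(1) y(2) by (auto simp: inj_on_def)
  moreover have "\<forall>e\<in>E. (c(x := y)) e \<in> S e" using c y by auto
  ultimately show ?case by blast
qed

text \<open>This is the case just beyond the reach of the greedy choice: one element more than each
  set has members. A value \<open>a\<close> in \<open>S x\<close> but not in \<open>S y\<close> is
  reserved for \<open>x\<close>. The \<open>m - 1\<close> elements other than \<open>x\<close> and
  \<open>y\<close> still have \<open>m - 1\<close> values each, and \<open>y\<close>, which loses
  nothing to \<open>a\<close>, has \<open>m\<close> values of which they occupy at most
  \<open>m - 1\<close>.\<close>

lemma uniform_sdr:
  fixes S :: "'e \<Rightarrow> 'c set"
  assumes "finite E" and "card E = Suc m" and fin: "\<And>e. e \<in> E \<Longrightarrow> finite (S e)"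
    and card: "\<And>e. e \<in> E \<Longrightarrow> card (S e) = m"
    and "x \<in> E" "y \<in> E" "S x \<noteq> S y"
  shows "\<exists>c. inj_on c E \<and> (\<forall>e\<in>E. c e \<in> S e)"
proof -
  have "\<not> S x \<subseteq> S y"
    using card_subset_eq[of "S y" "S x"] assms by auto
  then obtain a where a: "a \<in> S x" "a \<notin> S y" by blast
  let ?E = "E - {x, y}"
  have xy: "x \<noteq> y" using assms by auto
  have cE: "card ?E = m - 1"
    using assms(1,2,5,6) xy by (simp add: card_Diff_subset)
  have mpos: "m > 0" using card[OF \<open>x \<in> E\<close>] fin[OF \<open>x \<in> E\<close>] a card_gt_0_iff by blast
  have "\<exists>c. inj_on c ?E \<and> (\<forall>e\<in>?E. c e \<in> S e - {a})"
  proof (rule greedy_sdr)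
    fix t assume t: "1 \<le> t" "t \<le> card ?E"
    have "card (S e - {a}) \<ge> m - 1" if "e \<in> ?E" for e
      using card[of e] fin[of e] that by (cases "a \<in> S e") auto
    then have *: "{e \<in> ?E. card (S e - {a}) < t} = {}"
      using t cE by force
    show "card {e \<in> ?E. card (S e - {a}) < t} < t" unfolding * using t by simp
  qed (use assms in auto)
  then obtain c where c: "inj_on c ?E" "\<forall>e\<in>?E. c e \<in> S e - {a}" by blast
  have "card (c ` ?E) < card (S y)"
    using card_image_le[of ?E c] cE mpos assms(1) card[OF \<open>y \<in> E\<close>] by simp
  then have "\<not> S y \<subseteq> c ` ?E"
    using card_mono[of "c ` ?E" "S y"] assms(1) by force
  then obtain b where b: "b \<in> S y" "b \<notin> c ` ?E" by blast
  have ab: "a \<noteq> b" using a b by auto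
  have "inj_on (c(x := a, y := b)) E"
    unfolding inj_on_def
  proof (intro ballI impI)
    fix u v assume uv: "u \<in> E" "v \<in> E" "(c(x := a, y := b)) u = (c(x := a, y := b)) v"
    show "u = v"
      using uv c b ab xy inj_onD[OF c(1), of u v] by (auto split: if_splits)
  qed
  moreover have "\<forall>e\<in>E. (c(x := a, y := b)) e \<in> S e" using c a b by auto
  ultimately show ?thesis by blast
qed

section \<open>Light pairs among vertices chosen one after another\<close>

lemma nsets_2_eq_image: "nsets {..<l::nat} 2 = (\<lambda>(b,a). {a,b}) ` (SIGMA b:{..<l}. {..<b})"
  unfolding ordered_nsets_2_eq by (force simp: image_iff)

text \<open>
  With \<open>y = (l choose 2) - t\<close>, for \<open>b \<ge> 1\<close> at least \<open>max 1 (y * b / (k - t + 1))\<close> of the pairs \<open>{a, b}\<close>,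
  \<open>a < b\<close>, have weight at least \<open>t\<close>; the three cases in the proof are the ranges of \<open>t\<close> in which one of
  these two bounds, or integrality, suffices.
\<close>

lemma few_light_pairs:
  fixes v :: "nat set \<Rightarrow> nat"
  assumes "3 \<le> l" and k1: "(l choose 2) - 1 \<le> k" and k2: "2 * k + 1 < l\<^sup>2"
    and le: "\<And>p. v p \<le> k"
    and col: "\<And>b. b < l \<Longrightarrow> ((l choose 2) - 1) * b \<le> (\<Sum>a<b. v {a,b})"
    and t: "1 \<le> t" "t < l choose 2"
  shows "card {p \<in> nsets {..<l} 2. v p < t} < t"
proof -
  let ?M = "l choose 2"
  define B where "B b = {a. a < b \<and> v {a,b} < t}" for b
  define x where "x = k - (?M - 1)"
  define y where "y = ?M - t"
  have M: "2 * ?M = l * (l - 1)" by (cases l) (simp_all add: choose_two)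
  have k: "k + 1 = ?M + x" "y + t = ?M" "y \<ge> 1" using k1 t by (auto simp: x_def y_def)
  have finB: "finite (B b)" for b by (simp add: B_def)
  have Bcard: "card (B b) \<le> b" for b
    using card_mono[of "{..<b}" "B b"] by (auto simp: B_def)
  have "l * l = l * (l - 1) + l" using assms(1) by (cases l) auto
  then have l2: "l * l = 2 * ?M + l" using M by simp
  \<comment> \<open>The upper bound on \<open>k\<close> is used in this form: the excess
    \<open>x\<close> of \<open>k\<close> over \<open>m = ?M - 1\<close> is at most
    \<open>l / 2\<close>.\<close>
  then have x2: "2 * x \<le> l" using k2 k unfolding power2_eq_square by linarith
  \<comment> \<open>A light pair stays at least \<open>k + 1 - t = x + y\<close> below the maximal
    weight \<open>k\<close>, while column \<open>b\<close> as a whole stays at most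
    \<open>x * b\<close> below \<open>k * b\<close>.\<close>
  have col_bound: "card (B b) * (x + y) \<le> x * b" if "b < l" for b
  proof -
    have B: "card (B b) * (x + y) = (\<Sum>a<b. if a \<in> B b then x + y else 0)"
      by (subst sum.inter_filter[symmetric]) (auto simp: B_def intro!: arg_cong[of _ _ card])
    have "card (B b) * (x + y) + (?M - 1) * b
        \<le> (\<Sum>a<b. if a \<in> B b then x + y else 0) + (\<Sum>a<b. v {a,b})"
      using col[OF that] B by simp
    also have "\<dots> = (\<Sum>a<b. (if a \<in> B b then x + y else 0) + v {a,b})"
      by (simp add: sum.distrib)
    also have "\<dots> \<le> (\<Sum>a<b. k)"
    proof (rule sum_mono)
      fix a
      show "(if a \<in> B b then x + y else 0) + v {a,b} \<le> k"
        using le[of "{a,b}"] k by (auto simp: B_def)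
    qed
    also have "\<dots> = ((?M - 1) + x) * b" using k1 by (simp add: x_def)
    also have "\<dots> = (?M - 1) * b + x * b" by (rule distrib_right)
    finally show ?thesis by simp
  qed
  have "{p \<in> nsets {..<l} 2. v p < t} \<subseteq> (\<lambda>(b,a). {a,b}) ` (SIGMA b:{..<l}. B b)"
    unfolding nsets_2_eq_image by (auto simp: B_def)
  then have "card {p \<in> nsets {..<l} 2. v p < t} \<le> card ((\<lambda>(b,a). {a,b}) ` (SIGMA b:{..<l}. B b))"
    using finB by (intro card_mono) auto
  also have "\<dots> \<le> card (SIGMA b:{..<l}. B b)" using finB by (intro card_image_le) auto
  also have "\<dots> = (\<Sum>b<l. card (B b))" using finB by simp
  finally have 1: "card {p \<in> nsets {..<l} 2. v p < t} \<le> (\<Sum>b<l. card (B b))" .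
  have sumid: "(\<Sum>b<l. b) = ?M"
    using gauss_sum_nat[of "l - 1"] assms(1) M
    by (simp add: choose_two lessThan_Suc_atMost[symmetric] atLeast0AtMost mult.commute)
  \<comment> \<open>Counting the heavy pairs instead: since \<open>?M = y + t\<close>, fewer than
    \<open>t\<close> light pairs means more than \<open>y\<close> heavy ones.\<close>
  define g where "g b = b - card (B b)" for b
  have g: "card (B b) + g b = b" for b using Bcard by (simp add: g_def)
  have gsum: "(\<Sum>b<l. card (B b)) + (\<Sum>b<l. g b) = ?M"
    using g by (simp add: sum.distrib[symmetric] sumid)
  have gy: "y * b \<le> g b * (x + y)" if "b < l" for b
  proof -
    have "(card (B b) + g b) * (x + y) = b * (x + y)" using g by simp
    then show ?thesis using col_bound[OF that] by (simp add: algebra_simps)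
  qed
  consider "y + 2 \<le> l" | "x + y < ?M" | "?M \<le> x + y" by linarith
  then have "(\<Sum>b<l. card (B b)) < t"
  proof cases
    case 1
    have "(\<Sum>b\<in>{1..<l}. 1) \<le> (\<Sum>b\<in>{1..<l}. g b)"
    proof (rule sum_mono)
      fix b assume b: "b \<in> {1..<l}"
      then have "0 < g b * (x + y)" using gy[of b] k(3)
        by (metis atLeastLessThan_iff le_zero_eq less_one linorder_not_less mult_is_0 neq0_conv)
      then show "1 \<le> g b" by simp
    qed
    also have "\<dots> \<le> (\<Sum>b<l. g b)" by (rule sum_mono2) auto
    finally show ?thesis using gsum k 1 by simp
  next
    case 2
    have "y * ?M = (\<Sum>b<l. y * b)" by (simp add: sumid flip: sum_distrib_left)
    also have "\<dots> \<le> (\<Sum>b<l. g b * (x + y))" using gy by (intro sum_mono) auto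
    also have "\<dots> = (\<Sum>b<l. g b) * (x + y)" by (simp add: sum_distrib_right)
    finally have "y * ?M \<le> (\<Sum>b<l. g b) * (x + y)" .
    moreover have "y * (x + y) < y * ?M" using 2 k(3) by simp
    ultimately have "y * (x + y) < (\<Sum>b<l. g b) * (x + y)" by linarith
    then have "y < (\<Sum>b<l. g b)" by (rule mult_right_less_imp_less) simp
    then show ?thesis using gsum k by simp
  next
    case 3
    \<comment> \<open>Here \<open>t \<le> x\<close>, and
      \<open>x * (l - 1) \<le> ?M \<le> x + y\<close>. By \<open>col_bound\<close> and integrality
      only the last column can contain a light pair, and at most one.\<close>
    have "2 * (x * (l - 1)) \<le> 2 * ?M" unfolding M using x2
      by (metis mult.assoc mult_le_mono1)
    then have xl: "x * (l - 1) \<le> x + y" using 3 by linarith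
    have small: "card (B b) = 0" if "b < l" "x * b < x + y" for b
      using col_bound[OF that(1)] that(2)
      by (metis One_nat_def le_trans less_one linorder_not_less mult.left_neutral mult_le_mono1 not_less_eq_eq less_Suc0)
    have b0: "card (B b) = 0" if "b < l - 1" for b
    proof (rule small)
      show "b < l" using that by simp
      show "x * b < x + y"
      proof (cases "x = 0")
        case False
        then have "x * b < x * (l - 1)" using that by simp
        then show ?thesis using xl by (rule less_le_trans)
      qed (use k in auto)
    qed
    have "(\<Sum>b<l. card (B b)) = (\<Sum>b<Suc (l - 1). card (B b))" using assms(1) by simp
    also have "\<dots> = card (B (l - 1))" using b0 by simp
    finally have s: "(\<Sum>b<l. card (B b)) = card (B (l - 1))" .
    have "card (B (l - 1)) * (x + y) \<le> 1 * (x + y)"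
      using le_trans[OF col_bound xl] assms(1) by simp
    then have le1: "card (B (l - 1)) \<le> 1" using k(3) by (subst (asm) mult_le_cancel2) auto
    show ?thesis
    proof (cases "t = 1")
      case True
      have kx: "x + y = k" using k True by simp
      \<comment> \<open>For \<open>t = 1\<close> that single light pair has to be excluded as well,
        so the inequality must be strict; this follows from \<open>l > 2\<close>.\<close>
      have "x * (l - 1) < k"
      proof -
        obtain l' where l': "l = l' + 3" using assms(1) by (metis add.commute le_iff_add)
        have *: "2 * k + 2 = l * (l - 1) + 2 * x" using k M by simp
        have "2 * x * (l - 2) < l * (l - 1) - 2"
        proof -
          have "2 * x * (l - 2) \<le> l * (l - 2)" using x2 by simp
          also have "\<dots> < l * (l - 1) - 2" unfolding l' by (simp add: algebra_simps)
          finally show ?thesis .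
        qed
        then have "2 * x * (l - 2) + 2 * x < 2 * k" using * by linarith
        moreover have "2 * x * (l - 1) = 2 * x * (l - 2) + 2 * x"
          unfolding l' by (simp add: algebra_simps)
        ultimately show ?thesis by linarith
      qed
      then show ?thesis using small[of "l - 1"] kx s assms(1) True by simp
    next
      case False
      then show ?thesis using s le1 t by simp
    qed
  qed
  then show ?thesis using 1 by simp
qed

section \<open>Rainbow cliques and uniformity under a minimum degree condition\<close>

definition rainbow_clique :: "nat \<Rightarrow> ('v set \<Rightarrow> 'c set) \<Rightarrow> 'v set \<Rightarrow> bool" where
  "rainbow_clique l S U \<longleftrightarrow>
     (\<exists>f c. inj_on f {..<l} \<and> f ` {..<l} \<subseteq> U \<and> inj_on c (nsets {..<l} 2) \<and>
            (\<forall>p\<in>nsets {..<l} 2. c p \<in> S (f ` p)))"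

lemma rainbow_clique_mono: "rainbow_clique l S U \<Longrightarrow> U \<subseteq> V \<Longrightarrow> rainbow_clique l S V"
  unfolding rainbow_clique_def by (meson subset_trans)

text \<open>Only the total weight from a vertex to its predecessors is controlled, not the single
  weights: a minimum degree condition gives this much, and the count of light pairs asks for no
  more.\<close>

definition greedy_seq :: "nat \<Rightarrow> ('v set \<Rightarrow> 'c set) \<Rightarrow> 'v set \<Rightarrow> nat \<Rightarrow> (nat \<Rightarrow> 'v) \<Rightarrow> bool" where
  "greedy_seq m S U j f \<longleftrightarrow>
     inj_on f {..<j} \<and> f ` {..<j} \<subseteq> U \<and> (\<forall>b<j. m * b \<le> (\<Sum>a<b. card (S {f a, f b})))"

text \<open>The count of light pairs is the hypothesis of the greedy choice for all
  \<open>t \<le> m\<close>. A single pair of weight above \<open>m\<close> would supply the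
  remaining case \<open>t = m + 1\<close> and hence a rainbow clique. So all weights are at most
  \<open>m\<close>, the column sums force equality, and two different sets of size \<open>m\<close>
  would again admit distinct representatives.\<close>

lemma greedy_seq_uniform:
  fixes S :: "'v set \<Rightarrow> nat set"
  assumes "3 \<le> l" and m: "m = (l choose 2) - 1" and "m \<le> k" and k2: "2 * k + 1 < l\<^sup>2"
    and S: "\<And>p. S p \<subseteq> {1..k}"
    and f: "greedy_seq m S U l f" and nr: "\<not> rainbow_clique l S U"
    and p: "p \<in> nsets {..<l} 2" and q: "q \<in> nsets {..<l} 2"
  shows "card (S (f ` p)) = m \<and> S (f ` p) = S (f ` q)"
proof -
  let ?E = "nsets {..<l} 2"
  define v where "v p = card (S (f ` p))" for p
  have fin: "finite (S p)" for p using S by (rule finite_subset) simp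
  have vk: "v p \<le> k" for p using card_mono[OF _ S] by (auto simp: v_def)
  have finE: "finite ?E" by (simp add: finite_imp_finite_nsets)
  have cE: "card ?E = l choose 2" by simp
  have "(l choose 2) \<ge> (3 choose 2)" using assms(1) by (rule binomial_right_mono)
  then have Mpos: "(l choose 2) = Suc m" using m by (simp add: choose_two)
  have col: "m * b \<le> (\<Sum>a<b. v {a,b})" if "b < l" for b
    using f that by (simp add: greedy_seq_def v_def)
  have light: "card {p \<in> ?E. v p < t} < t" if "1 \<le> t" "t \<le> m" for t
  proof (rule few_light_pairs[OF assms(1) _ k2 vk])
    show "(l choose 2) - 1 \<le> k" using m assms(3) by simp
    show "((l choose 2) - 1) * b \<le> (\<Sum>a<b. v {a,b})" if "b < l" for b
      using col[OF that] unfolding m .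
    show "t < l choose 2" using that Mpos by linarith
  qed (use that in auto)
  have norain: "\<not> (\<exists>c. inj_on c ?E \<and> (\<forall>e\<in>?E. c e \<in> S (f ` e)))"
    using nr f unfolding rainbow_clique_def greedy_seq_def by blast
  have le: "v e \<le> m" if e: "e \<in> ?E" for e
  proof (rule ccontr)
    assume gt: "\<not> v e \<le> m"
    have "\<exists>c. inj_on c ?E \<and> (\<forall>e\<in>?E. c e \<in> S (f ` e))"
    proof (rule greedy_sdr[OF finE fin])
      fix t assume t: "1 \<le> t" "t \<le> card ?E"
      show "card {e \<in> ?E. card (S (f ` e)) < t} < t"
      proof (cases "t \<le> m")
        case True
        then show ?thesis using light[OF t(1)] by (simp add: v_def)
      next
        case False
        then have tM: "t = Suc m" using t cE Mpos by simp
        have "\<not> card (S (f ` e)) < t" using gt tM by (simp add: v_def)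
        then have "{e \<in> ?E. card (S (f ` e)) < t} \<subset> ?E" using e by blast
        then show ?thesis using psubset_card_mono[OF finE] cE tM Mpos by metis
      qed
    qed
    then show False using norain by blast
  qed
  have eq: "v e = m" if e: "e \<in> ?E" for e
  proof (rule ccontr)
    assume ne: "v e \<noteq> m"
    obtain a b where ab: "e = {a,b}" "a < b" "b < l"
      using e unfolding ordered_nsets_2_eq by auto
    have "(\<Sum>a<b. v {a,b}) < (\<Sum>a<b. m)"
    proof (rule sum_strict_mono_ex1)
      show "\<forall>a\<in>{..<b}. v {a,b} \<le> m" using ab le by auto
      show "\<exists>a\<in>{..<b}. v {a,b} < m" using ab ne le[OF e] by (intro bexI[of _ a]) auto
    qed simp
    then show False using col[OF ab(3)] by (simp add: mult.commute)
  qed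
  show ?thesis
  proof
    show "card (S (f ` p)) = m" using eq[OF p] by (simp add: v_def)
    show "S (f ` p) = S (f ` q)"
    proof (rule ccontr)
      assume "S (f ` p) \<noteq> S (f ` q)"
      then have "\<exists>c. inj_on c ?E \<and> (\<forall>e\<in>?E. c e \<in> S (f ` e))"
        using eq fin finE cE Mpos p q by (intro uniform_sdr[of ?E m _ p q]) (auto simp: v_def)
      then show False using norain by blast
    qed
  qed
qed

text \<open>Double counting between \<open>A\<close> and \<open>U - A\<close>. If every
  \<open>z\<close> outside \<open>A\<close> failed, it would fail by at least 1, and the slack
  \<open>1 / (2 * l)\<close>, collected over at most \<open>l\<close> vertices of \<open>A\<close>,
  restores at most \<open>1/2\<close>. The excess summed over \<open>A\<close> would then be at most
  \<open>- card (U - A) / 2\<close> plus a bounded contribution from pairs inside \<open>A\<close>,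
  which is negative for large \<open>U\<close>.\<close>

lemma heavy_extension:
  fixes w :: "'v \<Rightarrow> 'v \<Rightarrow> nat"
  assumes "finite U" and "A \<subseteq> U" and A: "card A \<le> l" and "0 < l"
    and wk: "\<And>u v. w u v \<le> k"
    and deg: "\<And>u. u \<in> U \<Longrightarrow> 0 \<le> (\<Sum>x\<in>U - {u}. real (w u x) - real m + 1 / (2 * real l))"
    and big: "card U > 2 * l\<^sup>2 * (k + 1) + l"
  shows "\<exists>z\<in>U - A. m * card A \<le> (\<Sum>a\<in>A. w a z)"
proof (rule ccontr)
  assume "\<not> ?thesis"
  then have less: "(\<Sum>a\<in>A. w a z) + 1 \<le> m * card A" if "z \<in> U - A" for z
    using that by (metis Suc_eq_plus1 Suc_leI not_le)
  let ?h = "\<lambda>a x. real (w a x) - real m + 1 / (2 * real l)"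
  have finA: "finite A" using assms(1,2) by (rule finite_subset[rotated])
  have split: "(\<Sum>x\<in>U - {a}. ?h a x) = (\<Sum>x\<in>U - A. ?h a x) + (\<Sum>x\<in>A - {a}. ?h a x)"
    if "a \<in> A" for a
  proof -
    have "U - {a} = (U - A) \<union> (A - {a})" using that assms(2) by auto
    then show ?thesis using assms(1) finA by (auto intro: sum.union_disjoint)
  qed
  have inner: "(\<Sum>x\<in>A - {a}. ?h a x) \<le> real l * (real k + 1)" for a
  proof -
    have "(\<Sum>x\<in>A - {a}. ?h a x) \<le> (\<Sum>x\<in>A - {a}. real k + 1)"
    proof (rule sum_mono)
      fix x
      have "1 / (2 * real l) \<le> 1" using assms(4) by simp
      then show "?h a x \<le> real k + 1" using wk[of a x] by linarith
    qed
    also have "\<dots> = real (card (A - {a})) * (real k + 1)" by simp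
    also have "\<dots> \<le> real l * (real k + 1)"
      using card_mono[OF finA, of "A - {a}"] A by (intro mult_right_mono) auto
    finally show ?thesis .
  qed
  have outer: "(\<Sum>a\<in>A. ?h a z) \<le> - (1/2)" if z: "z \<in> U - A" for z
  proof -
    have "(\<Sum>a\<in>A. ?h a z) = real (\<Sum>a\<in>A. w a z) - real m * card A + card A / (2 * real l)"
      by (simp add: sum.distrib sum_subtractf)
    moreover have "real (\<Sum>a\<in>A. w a z) + 1 \<le> real m * card A"
      using less[OF z] by (metis of_nat_1 of_nat_add of_nat_le_iff of_nat_mult)
    moreover have "card A / (2 * real l) \<le> 1/2" using A assms(4) by (simp add: field_simps)
    ultimately show ?thesis by linarith
  qed
  have "0 \<le> (\<Sum>a\<in>A. \<Sum>x\<in>U - {a}. ?h a x)"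
    by (rule sum_nonneg) (use deg assms(2) in blast)
  also have "\<dots> = (\<Sum>a\<in>A. \<Sum>x\<in>U - A. ?h a x) + (\<Sum>a\<in>A. \<Sum>x\<in>A - {a}. ?h a x)"
    using split by (simp add: sum.distrib)
  also have "(\<Sum>a\<in>A. \<Sum>x\<in>U - A. ?h a x) = (\<Sum>x\<in>U - A. \<Sum>a\<in>A. ?h a x)"
    by (rule sum.swap)
  also have "\<dots> \<le> (\<Sum>x\<in>U - A. - (1/2))" using outer by (rule sum_mono)
  also have "(\<Sum>a\<in>A. \<Sum>x\<in>A - {a}. ?h a x) \<le> (\<Sum>a\<in>A. real l * (real k + 1))"
    using inner by (rule sum_mono)
  also have "\<dots> \<le> real l * (real l * (real k + 1))"
    using A by (simp add: mult_right_mono)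
  finally have "real (card (U - A)) \<le> 2 * (real l * (real l * (real k + 1)))" by simp
  also have "\<dots> = real (2 * l\<^sup>2 * (k + 1))" by (simp add: power2_eq_square algebra_simps)
  finally have "card (U - A) \<le> 2 * l\<^sup>2 * (k + 1)" by (simp only: of_nat_le_iff)
  moreover have "card U \<le> card (U - A) + card A"
    using assms(1,2) by (metis card_Diff_subset diff_add finA card_mono le_refl)
  ultimately show False using big A by linarith
qed

text \<open>A pair of weight above \<open>m\<close>, or a triangle whose pairs all have weight
  \<open>m\<close>, is the start of a greedy sequence of length \<open>l\<close>, so uniformity of
  that sequence applies to it. Common neighbours along pairs of weight \<open>m\<close> then link
  any two pairs of weight \<open>m\<close>.\<close>

lemma min_degree_uniform:
  fixes S :: "'v set \<Rightarrow> nat set"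
  assumes l: "3 \<le> l" and m: "m = (l choose 2) - 1" and mk: "m \<le> k" and k2: "2 * k + 1 < l\<^sup>2"
    and finU: "finite U" and S: "\<And>p. S p \<subseteq> {1..k}"
    and deg: "\<And>u. u \<in> U \<Longrightarrow>
       0 \<le> (\<Sum>x\<in>U - {u}. real (card (S {u,x})) - real m + 1 / (2 * real l))"
    and big: "card U > 2 * l\<^sup>2 * (k + 1) + l"
    and nr: "\<not> rainbow_clique l S U"
  shows "\<exists>I\<subseteq>{1..k}. card I = m \<and>
    (\<forall>p\<in>nsets U 2. card (S p) \<le> m \<and> (card (S p) = m \<longrightarrow> S p = I))"
proof -
  have Sk: "card (S p) \<le> k" for p using card_mono[OF _ S] by fastforce
  have ext: "\<exists>z\<in>U - A. m * card A \<le> (\<Sum>a\<in>A. card (S {a,z}))" if "A \<subseteq> U" "card A \<le> l" for A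
    by (rule heavy_extension[of U A l "\<lambda>u x. card (S {u,x})" k m])
       (use finU that l Sk deg big in auto)
  \<comment> \<open>The induction runs from \<open>j = l\<close> downwards: one vertex is appended,
    and the case \<open>Suc j\<close> completes the sequence without altering its start.\<close>
  have extend: "\<exists>g. greedy_seq m S U l g \<and> (\<forall>i<j. g i = f i)"
    if jl: "j \<le> l" and f: "greedy_seq m S U j f" for j f
    using jl f
  proof (induction arbitrary: f rule: inc_induct)
    case base
    then show ?case by blast
  next
    case (step j)
    let ?A = "f ` {..<j}"
    have inj: "inj_on f {..<j}" and sub: "?A \<subseteq> U" using step.prems by (auto simp: greedy_seq_def)
    have "card ?A = j" using inj by (simp add: card_image)
    then obtain z where z: "z \<in> U - ?A" "m * j \<le> (\<Sum>a\<in>?A. card (S {a,z}))"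
      using ext[OF sub] step.hyps by fastforce
    have sz: "(\<Sum>a\<in>?A. card (S {a,z})) = (\<Sum>a<j. card (S {f a, z}))"
      using inj by (simp add: sum.reindex)
    let ?f = "f(j := z)"
    have "greedy_seq m S U (Suc j) ?f"
      unfolding greedy_seq_def
    proof (intro conjI allI impI)
      show "inj_on ?f {..<Suc j}" using inj z by (auto simp: inj_on_def less_Suc_eq)
      show "?f ` {..<Suc j} \<subseteq> U" using sub z by auto
      fix b assume "b < Suc j"
      then consider "b < j" | "b = j" by linarith
      then show "m * b \<le> (\<Sum>a<b. card (S {?f a, ?f b}))"
      proof cases
        case 1
        then show ?thesis using step.prems by (simp add: greedy_seq_def)
      next
        case 2
        then show ?thesis using z(2) sz by simp
      qed
    qed
    from step.IH[OF this] obtain g where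
      g: "greedy_seq m S U l g" "\<forall>i<Suc j. g i = ?f i" by blast
    then show ?case by (intro exI[of _ g]) auto
  qed
  have uniform: "card (S {f a, f b}) = m \<and> S {f a, f b} = S {f a', f b'}"
    if jf: "j \<le> l" "greedy_seq m S U j f" and "a < j" "b < j" "a' < j" "b' < j" "a \<noteq> b" "a' \<noteq> b'"
    for f j a b a' b'
  proof -
    obtain g where g: "greedy_seq m S U l g" "\<forall>i<j. g i = f i"
      using extend[OF jf] by blast
    have "{a,b} \<in> nsets {..<l} 2" "{a',b'} \<in> nsets {..<l} 2" using that by auto
    note gr = greedy_seq_uniform[OF l m mk k2 S g(1) nr this]
    have "g ` {a,b} = {f a, f b}" "g ` {a',b'} = {f a', f b'}" using g(2) that by auto
    then show ?thesis using gr by metis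
  qed
  have le: "card (S {u,v}) \<le> m" if uv: "u \<in> U" "v \<in> U" "u \<noteq> v" for u v
  proof (rule ccontr)
    assume gt: "\<not> card (S {u,v}) \<le> m"
    let ?f = "(\<lambda>_. v)(0 := u)"
    have "greedy_seq m S U 2 ?f"
      using uv gt by (auto simp: greedy_seq_def inj_on_def less_2_cases_iff)
    from uniform[OF _ this, of 0 1 0 1] show False using l gt by simp
  qed
  have triangle: "S {u,v} = S {u,x}"
    if "u \<in> U" "v \<in> U" "x \<in> U" "u \<noteq> v" "u \<noteq> x" "v \<noteq> x"
      "card (S {u,v}) = m" "card (S {u,x}) = m" "card (S {v,x}) = m" for u v x
  proof -
    let ?f = "(\<lambda>_. x)(0 := u, 1 := v)"
    have "b = 0 \<or> b = 1 \<or> b = 2" if "b < 3" for b :: nat using that by linarith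
    then have "greedy_seq m S U 3 ?f"
      using that
      by (auto simp: greedy_seq_def inj_on_def numeral_2_eq_2 numeral_3_eq_3 less_Suc_eq)
    from uniform[OF _ this, of 0 1 0 2] show ?thesis using l by simp
  qed
  \<comment> \<open>Now that no weight exceeds \<open>m\<close>, a total of
    \<open>m * card A\<close> leaves no room for a smaller one.\<close>
  have heavy: "\<exists>z\<in>U - A. \<forall>a\<in>A. card (S {a,z}) = m" if A: "A \<subseteq> U" "card A \<le> 3" for A
  proof -
    obtain z where z: "z \<in> U - A" "m * card A \<le> (\<Sum>a\<in>A. card (S {a,z}))"
      using ext[OF A(1)] A(2) l by fastforce
    have finA: "finite A" using A(1) finU by (rule finite_subset)
    have lez: "card (S {a,z}) \<le> m" if "a \<in> A" for a
      by (rule le) (use that A z in auto)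
    have "card (S {a,z}) = m" if a: "a \<in> A" for a
    proof (rule ccontr)
      assume "card (S {a,z}) \<noteq> m"
      then have "(\<Sum>a\<in>A. card (S {a,z})) < (\<Sum>a\<in>A. m)"
        using a lez finA by (intro sum_strict_mono_ex1) (auto intro!: bexI[of _ a] simp: le_neq_implies_less)
      then show False using z(2) by (simp add: mult.commute)
    qed
    then show ?thesis using z by blast
  qed
  \<comment> \<open>The pair \<open>{v,x}\<close> may be light. A common neighbour \<open>z\<close>
    gives two triangles of weight \<open>m\<close> that share \<open>{u,z}\<close>.\<close>
  have cherry: "S {u,v} = S {u,x}"
    if "u \<in> U" "v \<in> U" "x \<in> U" "u \<noteq> v" "u \<noteq> x" "card (S {u,v}) = m" "card (S {u,x}) = m" for u v x
  proof -
    have "card {u,v,x} \<le> 3" by (simp add: card_insert_if)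
    then obtain z where z: "z \<in> U - {u,v,x}" "\<forall>a\<in>{u,v,x}. card (S {a,z}) = m"
      using heavy[of "{u,v,x}"] \<open>u \<in> U\<close> \<open>v \<in> U\<close> \<open>x \<in> U\<close> by auto
    have "S {u,v} = S {u,z}" using that z by (intro triangle) auto
    also have "\<dots> = S {u,x}" using that z by (intro triangle[symmetric]) auto
    finally show ?thesis .
  qed
  \<comment> \<open>A common neighbour \<open>z\<close> of \<open>u\<close> and \<open>x\<close>
    completes a walk \<open>v, u, z, x, y\<close> along pairs of weight \<open>m\<close>, in which
    consecutive pairs form cherries.\<close>
  have pairs: "S {u,v} = S {x,y}"
    if "u \<in> U" "v \<in> U" "x \<in> U" "y \<in> U" "u \<noteq> v" "x \<noteq> y"
      "card (S {u,v}) = m" "card (S {x,y}) = m" for u v x y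
  proof -
    have "card {u,x} \<le> 3" by (simp add: card_insert_if)
    then obtain z where z: "z \<in> U - {u,x}" "\<forall>a\<in>{u,x}. card (S {a,z}) = m"
      using heavy[of "{u,x}"] \<open>u \<in> U\<close> \<open>x \<in> U\<close> by auto
    have "S {u,v} = S {u,z}" using that z by (intro cherry) auto
    also have "\<dots> = S {z,u}" by (simp add: insert_commute)
    also have "\<dots> = S {z,x}" using that z by (intro cherry) (auto simp: insert_commute)
    also have "\<dots> = S {x,z}" by (simp add: insert_commute)
    also have "\<dots> = S {x,y}" using that z by (intro cherry) auto
    finally show ?thesis .
  qed
  show ?thesis
  proof (cases "\<exists>p\<in>nsets U 2. card (S p) = m")
    case True
    then obtain p where p: "p \<in> nsets U 2" "card (S p) = m" by blast
    show ?thesis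
    proof (intro exI[of _ "S p"] conjI ballI impI)
      fix q assume "q \<in> nsets U 2"
      then show "card (S q) \<le> m" by (auto elim!: nsets2_E intro: le)
      show "S q = S p" if "card (S q) = m"
      proof -
        obtain u v x y where "u \<in> U" "v \<in> U" "u \<noteq> v" "q = {u,v}" "x \<in> U" "y \<in> U" "x \<noteq> y" "p = {x,y}"
          using p(1) \<open>q \<in> nsets U 2\<close> by (elim nsets2_E) metis
        then show ?thesis using that p(2) pairs by blast
      qed
    qed (use p S in auto)
  next
    case False
    \<comment> \<open>Without a pair of weight \<open>m\<close> the condition on \<open>I\<close> is
      vacuous, so any \<open>m\<close> of the \<open>k\<close> indices will do.\<close>
    show ?thesis
      by (rule exI[of _ "{1..m}"]) (use False mk le in \<open>auto elim!: nsets2_E\<close>)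
  qed
qed

section \<open>Stability for the weights of pairs\<close>

lemma sum_nsets_2_insert:
  assumes "finite A" "u \<notin> A"
  shows "sum f (nsets (insert u A) 2) = sum f (nsets A 2) + (\<Sum>x\<in>A. f {u,x})"
proof -
  have eq: "nsets (insert u A) 2 = nsets A 2 \<union> (\<lambda>x. {u,x}) ` A"
    using assms(2) by (fastforce simp: nsets_2_eq)
  have "sum f (nsets (insert u A) 2) = sum f (nsets A 2) + sum f ((\<lambda>x. {u,x}) ` A)"
    unfolding eq using assms
    by (intro sum.union_disjoint) (auto simp: finite_imp_finite_nsets)
  also have "sum f ((\<lambda>x. {u,x}) ` A) = (\<Sum>x\<in>A. f {u,x})"
    by (subst sum.reindex) (use assms(2) in \<open>auto simp: inj_on_def doubleton_eq_iff\<close>)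
  finally show ?thesis .
qed

text \<open>
  Instead of deleting vertices of small degree one by one, pass to the set \<open>U\<close> maximizing
  the excess \<open>g U\<close>: maximality bounds all degrees inside \<open>U\<close> from below.
\<close>

lemma graph_stability:
  fixes S :: "'v set \<Rightarrow> nat set" and C :: real
  assumes l: "3 \<le> l" and m: "m = (l choose 2) - 1" and mk: "m \<le> k" and k2: "2 * k + 1 < l\<^sup>2"
    and finV: "finite V" and S: "\<And>p. S p \<subseteq> {1..k}"
    and nr: "\<not> rainbow_clique l S V"
    and dense: "real m * real (card V choose 2) - C * real (card V) \<le> real (\<Sum>p\<in>nsets V 2. card (S p))"
    and big: "(real k + 1) * (real (2 * l\<^sup>2 * (k + 1) + l))\<^sup>2
               < real (card V choose 2) / (2 * real l) - C * real (card V)"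
  shows "\<exists>I\<subseteq>{1..k}. card I = m \<and>
    real (card {p \<in> nsets V 2. S p \<noteq> I}) \<le> 2 * real l * C * real (card V)"
proof -
  \<comment> \<open>This is the slack that \<open>heavy_extension\<close> tolerates. Adding it to
    every pair makes the excess of \<open>V\<close> grow quadratically, in spite of the linear error
    term.\<close>
  define \<epsilon> where "\<epsilon> = 1 / (2 * real l)"
  define h where "h p = real (card (S p)) - real m + \<epsilon>" for p
  define g where "g U = sum h (nsets U 2)" for U
  define N where "N = real (2 * l\<^sup>2 * (k + 1) + l)"
  have eps: "0 < \<epsilon>" "\<epsilon> \<le> 1" using l by (auto simp: \<epsilon>_def)
  have Sk: "card (S p) \<le> k" for p using card_mono[OF _ S] by fastforce
  have "Max (g ` Pow V) \<in> g ` Pow V" using finV by (intro Max_in) auto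
  then obtain U where U: "U \<subseteq> V" "g U = Max (g ` Pow V)" by auto
  have gmax: "g W \<le> g U" if "W \<subseteq> V" for W
    using U(2) that finV by (auto intro!: Max_ge)
  have finU: "finite U" using U(1) finV by (rule finite_subset)
  have gV: "\<epsilon> * real (card V choose 2) - C * real (card V) \<le> g V"
    using dense finV
    by (simp add: g_def h_def sum.distrib sum_subtractf algebra_simps)
  have deg: "0 \<le> (\<Sum>x\<in>U - {u}. real (card (S {u,x})) - real m + 1 / (2 * real l))" if "u \<in> U" for u
  proof -
    have "g U = g (U - {u}) + (\<Sum>x\<in>U - {u}. h {u,x})"
      unfolding g_def using sum_nsets_2_insert[of "U - {u}" u h] finU that
      by (simp add: insert_absorb)
    then show ?thesis using gmax[of "U - {u}"] U(1) by (auto simp: h_def \<epsilon>_def)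
  qed
  \<comment> \<open>The excess of \<open>U\<close> is at least that of \<open>V\<close>, but it is
    at most quadratic in \<open>card U\<close>; hence \<open>U\<close> is large enough for the
    minimum degree argument.\<close>
  have "g U \<le> (\<Sum>p\<in>nsets U 2. real k + 1)"
    unfolding g_def
  proof (rule sum_mono)
    show "h p \<le> real k + 1" for p using Sk[of p] eps by (simp add: h_def)
  qed
  also have "\<dots> = (real k + 1) * real (card U choose 2)" using finU by (simp)
  also have "\<dots> \<le> (real k + 1) * (real (card U))\<^sup>2"
  proof (rule mult_left_mono)
    have "card U choose 2 \<le> (card U)\<^sup>2"
      by (simp add: choose_two power2_eq_square) (metis div_le_dividend diff_le_self le_trans mult_le_mono2)
    then show "real (card U choose 2) \<le> (real (card U))\<^sup>2"
      by (metis of_nat_le_iff of_nat_power)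
  qed simp
  finally have gUk: "g U \<le> (real k + 1) * (real (card U))\<^sup>2" .
  have "(real k + 1) * N\<^sup>2 < g V"
    using big[folded N_def] gV by (simp add: \<epsilon>_def)
  then have "(real k + 1) * N\<^sup>2 < (real k + 1) * (real (card U))\<^sup>2"
    using gUk gmax[OF order_refl] by linarith
  then have "N\<^sup>2 < (real (card U))\<^sup>2"
    by (rule mult_left_less_imp_less) simp
  then have "N < real (card U)" by (rule power2_less_imp_less) simp
  then have bigU: "card U > 2 * l\<^sup>2 * (k + 1) + l" unfolding N_def by (simp only: of_nat_less_iff)
  have nrU: "\<not> rainbow_clique l S U"
    using nr rainbow_clique_mono[OF _ U(1)] by blast
  obtain I where I: "I \<subseteq> {1..k}" "card I = m"
      "\<And>p. p \<in> nsets U 2 \<Longrightarrow> card (S p) \<le> m"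
      "\<And>p. p \<in> nsets U 2 \<Longrightarrow> card (S p) = m \<Longrightarrow> S p = I"
    using min_degree_uniform[OF l m mk k2 finU S deg bigU nrU] by auto
  let ?X = "{p \<in> nsets U 2. card (S p) \<noteq> m}"
  have finX: "finite ?X" using finU by (simp add: finite_imp_finite_nsets)
  have "g U \<le> (\<Sum>p\<in>nsets U 2. \<epsilon> - (if card (S p) \<noteq> m then 1 else 0))"
    unfolding g_def
  proof (rule sum_mono)
    fix p assume "p \<in> nsets U 2"
    from I(3)[OF this] show "h p \<le> \<epsilon> - (if card (S p) \<noteq> m then 1 else 0)"
      by (auto simp: h_def)
  qed
  also have "\<dots> = \<epsilon> * real (card U choose 2) - real (card ?X)"
    using finU by (simp add: sum_subtractf sum.If_cases finite_imp_finite_nsets Int_def)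
  finally have gU: "g U \<le> \<epsilon> * real (card U choose 2) - real (card ?X)" .
  \<comment> \<open>Comparing \<open>g V \<le> g U\<close> with the two bounds \<open>gV\<close> and
    \<open>gU\<close> charges \<open>\<epsilon>\<close> to each pair not inside \<open>U\<close> and
    1 to each pair of \<open>?X\<close>, with total charge at most
    \<open>C * card V\<close>.\<close>
  have "{p \<in> nsets V 2. S p \<noteq> I} \<subseteq> (nsets V 2 - nsets U 2) \<union> ?X"
    using I(4) by auto
  then have "card {p \<in> nsets V 2. S p \<noteq> I} \<le> card ((nsets V 2 - nsets U 2) \<union> ?X)"
    using finV finX by (intro card_mono) (auto simp: finite_imp_finite_nsets)
  also have "\<dots> \<le> card (nsets V 2 - nsets U 2) + card ?X" by (rule card_Un_le)
  also have "real \<dots> = real (card V choose 2) - real (card U choose 2) + real (card ?X)"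
  proof -
    have "nsets U 2 \<subseteq> nsets V 2" using U(1) by (rule nsets_mono)
    moreover have "card U choose 2 \<le> card V choose 2"
      using card_mono[OF finV U(1)] by (rule binomial_right_mono)
    ultimately show ?thesis using finU finV
      by (simp add: card_Diff_subset finite_imp_finite_nsets of_nat_diff)
  qed
  finally have "\<epsilon> * real (card {p \<in> nsets V 2. S p \<noteq> I}) \<le>
      \<epsilon> * (real (card V choose 2) - real (card U choose 2) + real (card ?X))"
    using eps by simp
  also have "\<dots> \<le> \<epsilon> * (real (card V choose 2) - real (card U choose 2)) + real (card ?X)"
    using eps by (simp add: distrib_left mult_left_le_one_le)
  also have "\<dots> \<le> C * real (card V)" using gV gU gmax[of V] by (simp add: algebra_simps)
  finally have "real (card {p \<in> nsets V 2. S p \<noteq> I}) \<le> 2 * real l * C * real (card V)"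
    using l by (simp add: \<epsilon>_def field_simps)
  then show ?thesis using I by blast
qed

section \<open>Edges through a given set of vertices\<close>

lemma binomial_le_power: "n choose k \<le> n ^ k"
  by (cases "k \<le> n") (simp_all add: binomial_le_pow binomial_eq_0)

lemma card_supersets_le:
  assumes "finite V" "T \<subseteq> V"
  shows "card {e \<in> nsets V r. T \<subseteq> e} \<le> (card V - card T) choose (r - card T)"
proof -
  have "card {e \<in> nsets V r. T \<subseteq> e} \<le> card (nsets (V - T) (r - card T))"
  proof (rule card_inj_on_le[of "\<lambda>e. e - T"])
    show "inj_on (\<lambda>e. e - T) {e \<in> nsets V r. T \<subseteq> e}" by (auto simp: inj_on_def)
    show "(\<lambda>e. e - T) ` {e \<in> nsets V r. T \<subseteq> e} \<subseteq> nsets (V - T) (r - card T)"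
      by (auto simp: nsets_def card_Diff_subset finite_subset)
    show "finite (nsets (V - T) (r - card T))" using assms(1) by (simp add: finite_imp_finite_nsets)
  qed
  then show ?thesis using assms by (simp add: card_Diff_subset finite_subset)
qed

lemma card_supersets_le_power:
  assumes "finite V" "T \<subseteq> V"
  shows "card {e \<in> nsets V r. T \<subseteq> e} \<le> card V ^ (r - card T)"
proof -
  have "card {e \<in> nsets V r. T \<subseteq> e} \<le> (card V - card T) ^ (r - card T)"
    using card_supersets_le[OF assms] binomial_le_power by (rule le_trans)
  also have "\<dots> \<le> card V ^ (r - card T)" by (rule power_mono) auto
  finally show ?thesis .
qed

text \<open>Each vertex of \<open>Q\<close> lies, together with \<open>p\<close>, in at most
  \<open>card V ^ (r - 3)\<close> sets of size \<open>r\<close>, so the edges through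
  \<open>p\<close> that meet \<open>Q\<close> are too few to be all of them.\<close>

lemma avoiding_edge:
  assumes "finite V" and H: "H \<subseteq> nsets V r" and Q: "finite Q" "Q \<inter> p = {}" and p: "p \<subseteq> V" "card p = 2"
    and many: "card Q * card V ^ (r - 3) < card {e \<in> H. p \<subseteq> e}"
  shows "\<exists>e\<in>H. p \<subseteq> e \<and> e \<inter> Q = {}"
proof (rule ccontr)
  assume "\<not> ?thesis"
  then have sub: "{e \<in> H. p \<subseteq> e} \<subseteq> (\<Union>v\<in>Q \<inter> V. {e \<in> nsets V r. insert v p \<subseteq> e})"
    using H by (fastforce simp: nsets_def)
  have finp: "finite p" using p(1) assms(1) by (rule finite_subset)
  have "card {e \<in> H. p \<subseteq> e} \<le> card (\<Union>v\<in>Q \<inter> V. {e \<in> nsets V r. insert v p \<subseteq> e})"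
    using assms(1) by (intro card_mono sub) (auto simp: finite_imp_finite_nsets)
  also have "\<dots> \<le> (\<Sum>v\<in>Q \<inter> V. card {e \<in> nsets V r. insert v p \<subseteq> e})"
    using Q(1) by (intro card_UN_le) auto
  also have "\<dots> \<le> (\<Sum>v\<in>Q \<inter> V. card V ^ (r - 3))"
  proof (rule sum_mono)
    fix v assume v: "v \<in> Q \<inter> V"
    then have "card (insert v p) = 3" using Q(2) p(2) finp by (subst card_insert_disjoint) auto
    then show "card {e \<in> nsets V r. insert v p \<subseteq> e} \<le> card V ^ (r - 3)"
      using card_supersets_le_power[OF assms(1), of "insert v p" r] v p(1) by auto
  qed
  also have "\<dots> \<le> card Q * card V ^ (r - 3)"
    using Q(1) by (simp add: card_mono)
  finally show False using many by simp
qed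

section \<open>From a rainbow clique to a rainbow expansion\<close>

text \<open>The pairs of the clique are enlarged one at a time. The vertices to avoid are those of
  the clique and the \<open>r - 2\<close> new ones of each pair already treated, never more than
  \<open>l + (l choose 2) * (r - 2)\<close>, which explains the threshold.\<close>

lemma rainbow_expansion_of_clique:
  fixes S :: "'v set \<Rightarrow> 'c set" and H :: "'c \<Rightarrow> 'v set set"
  assumes finV: "finite V" and H: "\<And>i. i \<in> J \<Longrightarrow> H i \<subseteq> nsets V r"
    and S: "\<And>p i. i \<in> S p \<Longrightarrow> i \<in> J \<and>
      (l + (l choose 2) * (r - 2)) * card V ^ (r - 3) < card {e \<in> H i. p \<subseteq> e}"
    and "rainbow_clique l S V"
  shows "contains_rainbow_copy V J H (expansion r (complete_graph l))"
proof -
  let ?E = "nsets {..<l} 2"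
  obtain f c where f: "inj_on f {..<l}" "f ` {..<l} \<subseteq> V" and c: "inj_on c ?E"
    and cS: "\<And>p. p \<in> ?E \<Longrightarrow> c p \<in> S (f ` p)"
    using assms(4) unfolding rainbow_clique_def by blast
  have cJ: "c p \<in> J" if "p \<in> ?E" for p using S[OF cS[OF that]] by simp
  have finE: "finite ?E" by (simp add: finite_imp_finite_nsets)
  have fp: "card (f ` p) = 2" "f ` p \<subseteq> f ` {..<l}" "f ` p \<subseteq> V" "finite (f ` p)" if "p \<in> ?E" for p
  proof -
    have p: "p \<subseteq> {..<l}" "card p = 2" "finite p" using that by (auto simp: nsets_def)
    show "card (f ` p) = 2" using p card_image[OF inj_on_subset[OF f(1) p(1)]] by simp
    show "f ` p \<subseteq> f ` {..<l}" "f ` p \<subseteq> V" "finite (f ` p)" using p f(2) by auto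
  qed
  have disj: "A \<inter> B = {}" if "A' \<inter> B' = {}" "A \<subseteq> A'" "B \<subseteq> B'" for A B A' B' :: "'v set"
    using that by blast
  define good where "good F \<psi> \<longleftrightarrow>
      (\<forall>p\<in>F. \<psi> p \<in> H (c p) \<and> f ` p \<subseteq> \<psi> p \<and> (\<psi> p - f ` p) \<inter> f ` {..<l} = {}) \<and>
      (\<forall>p\<in>F. \<forall>p'\<in>F. p \<noteq> p' \<longrightarrow> (\<psi> p - f ` p) \<inter> (\<psi> p' - f ` p') = {})" for F \<psi>
  have "\<exists>\<psi>. good F \<psi>"
    if "F \<subseteq> ?E" for F
    using finite_subset[OF that finE] that
  proof (induction rule: finite_induct)
    case empty
    then show ?case by (simp add: good_def)
  next
    case (insert x F)
    then obtain \<psi> where "good F \<psi>"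
      by auto
    then have
      \<psi>: "\<And>p. p \<in> F \<Longrightarrow> \<psi> p \<in> H (c p) \<and> f ` p \<subseteq> \<psi> p \<and> (\<psi> p - f ` p) \<inter> f ` {..<l} = {}"
        "\<And>p p'. p \<in> F \<Longrightarrow> p' \<in> F \<Longrightarrow> p \<noteq> p' \<Longrightarrow> (\<psi> p - f ` p) \<inter> (\<psi> p' - f ` p') = {}"
      unfolding good_def by simp_all
    have x: "x \<in> ?E" and F: "F \<subseteq> ?E" using insert.prems by auto
    \<comment> \<open>The two vertices of the current pair are left out of \<open>Q\<close>, because
      the new edge has to contain them.\<close>
    define Q where "Q = (f ` {..<l} - f ` x) \<union> (\<Union>p\<in>F. \<psi> p - f ` p)"
    have \<psi>r: "\<psi> p \<in> nsets V r" if "p \<in> F" for p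
      using \<psi>(1)[OF that] H[OF cJ] F that by auto
    have "card Q \<le> card (f ` {..<l} - f ` x) + card (\<Union>p\<in>F. \<psi> p - f ` p)"
      unfolding Q_def by (rule card_Un_le)
    also have "card (f ` {..<l} - f ` x) \<le> l"
      using card_mono[of "f ` {..<l}" "f ` {..<l} - f ` x"] card_image_le[of "{..<l}" f] by auto
    also have "card (\<Union>p\<in>F. \<psi> p - f ` p) \<le> (\<Sum>p\<in>F. card (\<psi> p - f ` p))"
      using insert.hyps(1) by (rule card_UN_le)
    also have "\<dots> = (\<Sum>p\<in>F. r - 2)"
    proof (rule sum.cong)
      fix p assume p: "p \<in> F"
      then have "p \<in> ?E" using F by auto
      from fp[OF this] show "card (\<psi> p - f ` p) = r - 2"
        using \<psi>(1)[OF p] \<psi>r[OF p] by (simp add: card_Diff_subset nsets_def)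
    qed simp
    also have "\<dots> = card F * (r - 2)" by simp
    also have "\<dots> \<le> (l choose 2) * (r - 2)"
      using card_mono[OF finE F] by (simp)
    finally have cQ: "card Q \<le> l + (l choose 2) * (r - 2)" by simp
    have Q1: "finite Q" unfolding Q_def using insert.hyps(1) \<psi>r by (auto simp: nsets_def)
    have Q2: "Q \<inter> f ` x = {}"
    proof -
      have "f ` x \<inter> (\<psi> p - f ` p) = {}" if "p \<in> F" for p
        by (subst Int_commute) (rule disj[OF _ order_refl fp(2)[OF x]], use \<psi>(1)[OF that] in simp)
      then show ?thesis
        unfolding Q_def by (simp add: Int_commute[of _ "f ` x"] Int_Un_distrib Int_UN_distrib)
    qed
    have Q3: "card Q * card V ^ (r - 3) < card {e \<in> H (c x). f ` x \<subseteq> e}"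
      using S[OF cS[OF x]] mult_le_mono1[OF cQ, of "card V ^ (r - 3)"] by linarith
    obtain e where e: "e \<in> H (c x)" "f ` x \<subseteq> e" "e \<inter> Q = {}"
      using avoiding_edge[OF finV H[OF cJ[OF x]] Q1 Q2 fp(3)[OF x] fp(1)[OF x] Q3] by metis
    have eF: "(e - f ` x) \<inter> (\<psi> p - f ` p) = {}" if "p \<in> F" for p
    proof -
      have "\<psi> p - f ` p \<subseteq> Q" unfolding Q_def using that by (intro le_supI2 UN_upper)
      from disj[OF e(3) Diff_subset this] show ?thesis .
    qed
    have gen: "(e - X) \<inter> K = {}" if "e \<inter> Q = {}" "K - X \<subseteq> Q" for K X :: "'v set"
      using that by blast
    have "(e - f ` x) \<inter> f ` {..<l} = {}" using e(3) by (rule gen) (simp add: Q_def)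
    then show ?case
      using \<psi> e(1,2) eF insert.hyps(2)
      by (intro exI[of _ "\<psi>(x := e)"]) (auto simp: good_def Int_commute)
  qed
  from this[OF order_refl] obtain \<psi> where "good ?E \<psi>"
    by blast
  then have
    \<psi>: "\<And>p. p \<in> ?E \<Longrightarrow> \<psi> p \<in> H (c p) \<and> f ` p \<subseteq> \<psi> p \<and> (\<psi> p - f ` p) \<inter> f ` {..<l} = {}"
      "\<And>p p'. p \<in> ?E \<Longrightarrow> p' \<in> ?E \<Longrightarrow> p \<noteq> p' \<Longrightarrow> (\<psi> p - f ` p) \<inter> (\<psi> p' - f ` p') = {}"
    unfolding good_def by simp_all
  have \<psi>r: "\<psi> p \<in> nsets V r" if "p \<in> ?E" for p
    using \<psi>(1)[OF that] H[OF cJ[OF that]] by auto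
  have "\<exists>g. bij_betw g {..<r - 2} (\<psi> p - f ` p)" if "p \<in> ?E" for p
  proof -
    have "finite (\<psi> p - f ` p)" using \<psi>r[OF that] by (auto simp: nsets_def)
    moreover have "card (\<psi> p - f ` p) = r - 2"
      using \<psi>(1)[OF that] \<psi>r[OF that] fp[OF that] by (simp add: card_Diff_subset nsets_def)
    ultimately show ?thesis using ex_bij_betw_nat_finite by (metis atLeast0LessThan)
  qed
  then obtain g where g: "\<And>p. p \<in> ?E \<Longrightarrow> bij_betw (g p) {..<r - 2} (\<psi> p - f ` p)"
    by metis
  define \<phi> where "\<phi> = case_sum f (\<lambda>(p, j). g p j)"
  have \<phi>I [simp]: "\<phi> (Inl a) = f a" "\<phi> (Inr (p, j)) = g p j" for a p j by (auto simp: \<phi>_def)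
  have gin: "g p j \<in> \<psi> p - f ` p" if "p \<in> ?E" "j < r - 2" for p j
    using g[OF that(1)] that(2) by (auto simp: bij_betw_def)
  have gV: "g p j \<in> V" if "p \<in> ?E" "j < r - 2" for p j
  proof -
    have "\<psi> p \<subseteq> V" using \<psi>r[OF that(1)] by (simp add: nsets_def)
    then show ?thesis using gin[OF that] by (simp add: subsetD)
  qed
  have ginj: "j = j'" if "p \<in> ?E" "j < r - 2" "j' < r - 2" "g p j = g p j'" for p j j'
    using g[OF that(1)] that by (auto simp: bij_betw_def inj_on_def)
  have gnf: "g p j \<noteq> f a" if "p \<in> ?E" "j < r - 2" "a < l" for p j a
    using gin[OF that(1,2)] \<psi>(1)[OF that(1)] that(3) by blast
  have gpp: "p = p'" if "p \<in> ?E" "p' \<in> ?E" "j < r - 2" "j' < r - 2" "g p j = g p' j'" for p p' j j'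
    using gin[OF that(1,3)] gin[OF that(2,4)] \<psi>(2)[OF that(1,2)] that(5) by auto
  have injp: "inj_on \<phi> (Inl ` {..<l} \<union> Inr ` (?E \<times> {..<r - 2}))"
  proof (rule inj_onI)
    fix u v
    assume "u \<in> Inl ` {..<l} \<union> Inr ` (?E \<times> {..<r - 2})" "v \<in> Inl ` {..<l} \<union> Inr ` (?E \<times> {..<r - 2})"
      and eq: "\<phi> u = \<phi> v"
    then consider a b where "u = Inl a" "v = Inl b" "a < l" "b < l"
      | a p j where "u = Inl a" "v = Inr (p, j)" "a < l" "p \<in> ?E" "j < r - 2"
      | a p j where "v = Inl a" "u = Inr (p, j)" "a < l" "p \<in> ?E" "j < r - 2"
      | p j p' j' where "u = Inr (p, j)" "v = Inr (p', j')" "p \<in> ?E" "j < r - 2" "p' \<in> ?E" "j' < r - 2"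
      by blast
    then show "u = v"
    proof cases
      case 1
      then show ?thesis using eq f(1) by (auto simp: inj_on_def)
    next
      case 2
      then show ?thesis using eq gnf[of p j a] by simp
    next
      case 3
      then show ?thesis using eq gnf[of p j a] by simp
    next
      case 4
      then have "p = p'" using eq gpp[of p p' j j'] by simp
      then show ?thesis using 4 eq ginj[of p j j'] by simp
    qed
  qed
  \<comment> \<open>The original vertices of an expanded edge recover its pair, so a colouring of
    pairs can be read as a colouring of expanded edges.\<close>
  have vimg: "Inl -` expand_edge r p = p" for p :: "nat set"
    by (auto simp: expand_edge_def)
  have im: "\<phi> ` expand_edge r p = \<psi> p" if "p \<in> ?E" for p
  proof -
    have "\<phi> ` expand_edge r p = f ` p \<union> g p ` {..<r - 2}"
      by (force simp: expand_edge_def image_iff)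
    also have "g p ` {..<r - 2} = \<psi> p - f ` p" using g[OF that] by (simp add: bij_betw_def)
    finally show ?thesis using \<psi>(1)[OF that] by blast
  qed
  show ?thesis
    unfolding contains_rainbow_copy_def
  proof (intro exI[of _ \<phi>] exI[of _ "\<lambda>e. c (Inl -` e)"] conjI)
    show "inj_on \<phi> (fst (expansion r (complete_graph l)))"
      using injp by (simp add: expansion_def complete_graph_def)
    show "\<phi> ` fst (expansion r (complete_graph l)) \<subseteq> V"
      using f(2) gV by (auto simp: expansion_def complete_graph_def)
    show "inj_on (\<lambda>e. c (Inl -` e)) (snd (expansion r (complete_graph l)))"
      using c by (auto simp: expansion_def complete_graph_def vimg inj_on_def)
    show "(\<lambda>e. c (Inl -` e)) ` snd (expansion r (complete_graph l)) \<subseteq> J"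
      using cJ by (auto simp: expansion_def complete_graph_def vimg)
    show "\<forall>e\<in>snd (expansion r (complete_graph l)). \<phi> ` e \<in> H (c (Inl -` e))"
      using \<psi>(1) im by (auto simp: expansion_def complete_graph_def vimg)
  qed
qed

section \<open>Transfer between edges and pairs\<close>

lemma sum_nsets_pairs_le:
  fixes w :: "'v set \<Rightarrow> nat"
  assumes "finite V"
  shows "(\<Sum>e\<in>nsets V r. \<Sum>p\<in>nsets e 2. w p)
    \<le> ((card V - 2) choose (r - 2)) * (\<Sum>p\<in>nsets V 2. w p)"
proof -
  have fin: "finite (nsets V i)" for i using assms by (rule finite_imp_finite_nsets)
  have "nsets e 2 = {p \<in> nsets V 2. p \<subseteq> e}" if "e \<in> nsets V r" for e
    using that by (auto simp: nsets_def intro: finite_subset)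
  then have "(\<Sum>e\<in>nsets V r. \<Sum>p\<in>nsets e 2. w p) = (\<Sum>e\<in>nsets V r. \<Sum>p\<in>nsets V 2. if p \<subseteq> e then w p else 0)"
    using fin by (simp add: sum.inter_filter)
  also have "\<dots> = (\<Sum>p\<in>nsets V 2. \<Sum>e\<in>nsets V r. if p \<subseteq> e then w p else 0)"
    by (rule sum.swap)
  also have "\<dots> = (\<Sum>p\<in>nsets V 2. card {e \<in> nsets V r. p \<subseteq> e} * w p)"
    using fin by (simp flip: sum.inter_filter)
  also have "\<dots> \<le> (\<Sum>p\<in>nsets V 2. ((card V - 2) choose (r - 2)) * w p)"
  proof (intro sum_mono mult_right_mono)
    fix p assume "p \<in> nsets V 2"
    then show "card {e \<in> nsets V r. p \<subseteq> e} \<le> (card V - 2) choose (r - 2)"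
      using card_supersets_le[OF assms, of p r] by (simp add: nsets_def)
  qed simp
  finally show ?thesis by (simp add: sum_distrib_left)
qed

text \<open>From \<open>(N choose j) \<ge> (N / j) ^ j\<close> and \<open>n - 2 \<ge> n / 2\<close>;
  \<open>r = 2\<close> is treated apart because \<open>r - 2\<close> becomes a denominator. The
  estimate serves to turn an error of order \<open>n ^ (r - 1)\<close> for edges into one of order
  \<open>n\<close> for pairs.\<close>

lemma binomial_ge_power:
  assumes "4 \<le> n" "r \<le> n" "2 \<le> r"
  shows "real n ^ (r - 2) \<le> (2 * real r) ^ (r - 2) * real ((n - 2) choose (r - 2))"
proof (cases "r = 2")
  case False
  have "real n / (2 * real r) \<le> real (n - 2) / real (r - 2)"
  proof -
    have "real n * real (r - 2) \<le> real n * real r" by (simp add: mult_left_mono)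
    also have "\<dots> \<le> (2 * real (n - 2)) * real r"
      by (rule mult_right_mono) (use assms in auto)
    finally show ?thesis using assms False by (simp add: field_simps)
  qed
  then have "(real n / (2 * real r)) ^ (r - 2) \<le> (real (n - 2) / real (r - 2)) ^ (r - 2)"
    by (rule power_mono) simp
  also have "\<dots> \<le> real ((n - 2) choose (r - 2))"
    using assms by (intro binomial_ge_n_over_k_pow_k) simp
  finally show ?thesis using assms(3) by (simp add: power_divide field_simps)
qed simp

text \<open>Here \<open>T e\<close> plays the colours of an edge and \<open>S p\<close> those of a
  pair. Outside \<open>L\<close> the colours of an edge belong to all its \<open>r choose 2\<close>
  pairs, so double counting carries the density of edges over to pairs. The edges in
  \<open>L\<close> account for the term \<open>k * K\<close> in \<open>C2\<close>.\<close>

lemma dense_shadow: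
  fixes S T :: "'v set \<Rightarrow> nat set" and C K :: real and k m r :: nat
  defines "C2 \<equiv> real (r choose 2) * (C + real k * K) * (2 * real r) ^ (r - 2)"
  assumes finV: "finite V" and r: "2 \<le> r" "r \<le> card V" and n: "4 \<le> card V" and "0 \<le> C" "0 \<le> K"
    and T: "\<And>e. card (T e) \<le> k" and S: "\<And>p. finite (S p)"
    and L: "L \<subseteq> nsets V r" "real (card L) \<le> K * real (card V) ^ (r - 1)"
    and TS: "\<And>e p. e \<in> nsets V r - L \<Longrightarrow> p \<in> nsets e 2 \<Longrightarrow> T e \<subseteq> S p"
    and dense: "real m * real (card V choose r) - C * real (card V) ^ (r - 1)
      \<le> real (\<Sum>e\<in>nsets V r. card (T e))"
  shows "real m * real (card V choose 2) - C2 * real (card V) \<le> real (\<Sum>p\<in>nsets V 2. card (S p))"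
proof -
  let ?n = "card V" and ?R = "nsets V r"
  let ?W = "\<Sum>p\<in>nsets V 2. card (S p)"
  define b where "b = (?n - 2) choose (r - 2)"
  define N where "N = real ?n ^ (r - 1)"
  have fin: "finite (nsets V i)" for i using finV by (rule finite_imp_finite_nsets)
  have finL: "finite L" using L(1) fin by (rule finite_subset)
  have pairs: "(r choose 2) * card (T e) \<le> (\<Sum>p\<in>nsets e 2. card (S p))" if e: "e \<in> ?R - L" for e
  proof -
    have "finite e" "card e = r" using e by (auto simp: nsets_def)
    then have "card (nsets e 2) = r choose 2" by (simp)
    moreover have "(\<Sum>p\<in>nsets e 2. card (T e)) \<le> (\<Sum>p\<in>nsets e 2. card (S p))"
      using TS[OF e] S by (intro sum_mono card_mono) auto
    ultimately show ?thesis by simp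
  qed
  have "(\<Sum>e\<in>?R. card (T e)) = (\<Sum>e\<in>?R - L. card (T e)) + (\<Sum>e\<in>L. card (T e))"
    using L(1) fin by (rule sum.subset_diff)
  also have "(\<Sum>e\<in>L. card (T e)) \<le> card L * k" using sum_bounded_above[of L "\<lambda>e. card (T e)" k] T by simp
  finally have "(r choose 2) * (\<Sum>e\<in>?R. card (T e))
      \<le> (r choose 2) * ((\<Sum>e\<in>?R - L. card (T e)) + card L * k)" by simp
  also have "\<dots> = (\<Sum>e\<in>?R - L. (r choose 2) * card (T e)) + (r choose 2) * (card L * k)"
    by (simp add: sum_distrib_left distrib_left)
  also have "(\<Sum>e\<in>?R - L. (r choose 2) * card (T e)) \<le> (\<Sum>e\<in>?R - L. \<Sum>p\<in>nsets e 2. card (S p))"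
    using pairs by (rule sum_mono)
  also have "\<dots> \<le> (\<Sum>e\<in>?R. \<Sum>p\<in>nsets e 2. card (S p))"
    using fin by (intro sum_mono2) auto
  also have "\<dots> \<le> b * ?W" unfolding b_def by (rule sum_nsets_pairs_le[OF finV])
  finally have "real ((r choose 2) * (\<Sum>e\<in>?R. card (T e))) \<le> real (b * ?W + (r choose 2) * (card L * k))"
    by (simp only: of_nat_le_iff add_le_mono)
  then have 1: "real (r choose 2) * real (\<Sum>e\<in>?R. card (T e)) \<le> real b * real ?W + real (r choose 2) * (real k * real (card L))"
    by (simp add: mult.commute)
  also have "\<dots> \<le> real b * real ?W + real (r choose 2) * (real k * (K * N))"
    using L(2) by (intro add_left_mono mult_left_mono) (auto simp: N_def)
  finally have 2: "real (r choose 2) * real (\<Sum>e\<in>?R. card (T e))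
      \<le> real b * real ?W + real (r choose 2) * (real k * (K * N))" .
  have "real (r choose 2) * (real m * real (?n choose r) - C * N)
      \<le> real (r choose 2) * real (\<Sum>e\<in>?R. card (T e))"
    using dense by (intro mult_left_mono) (auto simp: N_def)
  with 2 have 3: "real m * (real (?n choose r) * real (r choose 2)) - real (r choose 2) * (C + real k * K) * N
      \<le> real b * real ?W" by (simp add: algebra_simps)
  \<comment> \<open>Both sides count the pairs inside \<open>r\<close>-sets, so the main terms agree
    exactly after division by \<open>b\<close>.\<close>
  have "real (?n choose r) * real (r choose 2) = real (?n choose 2) * real b"
    unfolding b_def using choose_mult[of 2 r ?n] r by (metis of_nat_mult)
  with 3 have 4: "real b * (real m * real (?n choose 2) - real ?W) \<le> real (r choose 2) * (C + real k * K) * N"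
    by (simp add: algebra_simps)
  have N: "N = real ?n * real ?n ^ (r - 2)"
    unfolding N_def using r(1) by (metis Suc_diff_le diff_Suc_Suc numeral_2_eq_2 One_nat_def power_Suc)
  have bpos: "b > 0" using r unfolding b_def by simp
  have "real (r choose 2) * (C + real k * K) * N
      \<le> real (r choose 2) * (C + real k * K) * (real ?n * ((2 * real r) ^ (r - 2) * real b))"
    unfolding N b_def using binomial_ge_power[OF n r(2,1)] assms(6,7)
    by (intro mult_left_mono) auto
  also have "\<dots> = real b * (C2 * real ?n)" by (simp add: C2_def)
  finally have "real b * (real m * real (?n choose 2) - real ?W) \<le> real b * (C2 * real ?n)"
    using 4 by linarith
  then show ?thesis using bpos by simp
qed

text \<open>An edge outside \<open>L\<close> without exceptional pairs has its colours inside
  \<open>I\<close>, hence at most \<open>m\<close> of them, and exactly \<open>m\<close> only if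
  they form \<open>I\<close>. The density leaves room for few edges with less than \<open>m\<close>
  colours.\<close>

lemma uniform_edges:
  fixes S T :: "'v set \<Rightarrow> nat set" and C K K' :: real
  assumes finV: "finite V" and r: "2 \<le> r"
    and T: "\<And>e. card (T e) \<le> k" and I: "finite I" "card I = m"
    and L: "L \<subseteq> nsets V r" "real (card L) \<le> K * real (card V) ^ (r - 1)"
    and TS: "\<And>e p. e \<in> nsets V r - L \<Longrightarrow> p \<in> nsets e 2 \<Longrightarrow> T e \<subseteq> S p"
    and few: "real (card {p \<in> nsets V 2. S p \<noteq> I}) \<le> K' * real (card V)"
    and dense: "real m * real (card V choose r) - C * real (card V) ^ (r - 1)
      \<le> real (\<Sum>e\<in>nsets V r. card (T e))"
  shows "real (card {e \<in> nsets V r. T e \<noteq> I}) \<le> ((real k + 1) * (K + K') + C) * real (card V) ^ (r - 1)"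
proof -
  let ?n = "card V" and ?R = "nsets V r" and ?P = "{p \<in> nsets V 2. S p \<noteq> I}"
  let ?X = "{e \<in> ?R. T e \<noteq> I}"
  define N where "N = real ?n ^ (r - 1)"
  have fin: "finite (nsets V i)" for i using finV by (rule finite_imp_finite_nsets)
  define B where "B = (\<Union>p\<in>?P. {e \<in> ?R. p \<subseteq> e})"
  have "card B \<le> (\<Sum>p\<in>?P. card {e \<in> ?R. p \<subseteq> e})"
    unfolding B_def using fin by (intro card_UN_le) simp
  also have "\<dots> \<le> (\<Sum>p\<in>?P. ?n ^ (r - 2))"
  proof (rule sum_mono)
    fix p assume "p \<in> ?P"
    then show "card {e \<in> ?R. p \<subseteq> e} \<le> ?n ^ (r - 2)"
      using card_supersets_le_power[OF finV, of p r] by (simp add: nsets_def)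
  qed
  finally have "real (card B) \<le> real (card ?P) * real ?n ^ (r - 2)"
    by (simp flip: of_nat_power of_nat_mult)
  also have "\<dots> \<le> (K' * real ?n) * real ?n ^ (r - 2)"
    using few by (rule mult_right_mono) simp
  also have "\<dots> = K' * N"
    unfolding N_def using r by (simp add: mult.assoc) (metis Suc_diff_le diff_Suc_Suc numeral_2_eq_2 One_nat_def power_Suc)
  finally have B: "real (card B) \<le> K' * N" .
  define D where "D = L \<union> B"
  have DR: "D \<subseteq> ?R" using L(1) by (auto simp: D_def B_def)
  have finD: "finite D" using DR fin by (rule finite_subset)
  have cD: "real (card D) \<le> (K + K') * N"
    using card_Un_le[of L B] L(2) B unfolding D_def N_def by (simp add: distrib_right)
  have TI: "T e \<subseteq> I" if e: "e \<in> ?R - D" for e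
  proof -
    have "finite e" "card e = r" using e by (auto simp: nsets_def)
    then have "nsets e 2 \<noteq> {}" using r by (simp add: nsets_eq_empty_iff)
    then obtain p where p: "p \<in> nsets e 2" by blast
    then have "p \<in> nsets V 2" "p \<subseteq> e" using e by (auto simp: nsets_def)
    moreover have "T e \<subseteq> S p" using TS[OF _ p] e by (simp add: D_def)
    ultimately show ?thesis using e by (auto simp: D_def B_def)
  qed
  \<comment> \<open>An edge in \<open>D\<close> can exceed \<open>m\<close> by up to
    \<open>k\<close> colours and by 1 for membership in \<open>?X\<close>; any other edge of
    \<open>?X\<close> has at most \<open>m - 1\<close> colours.\<close>
  have le: "card (T e) + (if e \<in> ?X then 1 else 0) \<le> m + (if e \<in> D then k + 1 else 0)" if "e \<in> ?R" for e
  proof (cases "e \<in> D")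
    case True
    then show ?thesis using T[of e] by simp
  next
    case False
    with that TI have "T e \<subseteq> I" by simp
    then have "T e = I \<or> card (T e) < card I" using psubset_card_mono[OF I(1)] by blast
    then show ?thesis using I(2) False by auto
  qed
  have "(\<Sum>e\<in>?R. card (T e)) + card ?X = (\<Sum>e\<in>?R. card (T e) + (if e \<in> ?X then 1 else 0))"
    using fin by (simp add: sum.distrib flip: sum.inter_filter)
  also have "\<dots> \<le> (\<Sum>e\<in>?R. m + (if e \<in> D then k + 1 else 0))" using le by (rule sum_mono)
  also have "\<dots> = (?n choose r) * m + (\<Sum>e\<in>?R. if e \<in> D then k + 1 else 0)"
    using finV by (simp only: sum.distrib) (simp)
  also have "(\<Sum>e\<in>?R. if e \<in> D then k + 1 else 0) = card D * (k + 1)"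
  proof -
    have "{e \<in> ?R. e \<in> D} = D" using DR by auto
    then show ?thesis using fin sum.inter_filter[of ?R "\<lambda>_. k + 1" "\<lambda>e. e \<in> D"] by simp
  qed
  finally have "real ((\<Sum>e\<in>?R. card (T e)) + card ?X) \<le> real ((?n choose r) * m + card D * (k + 1))"
    by (simp only: of_nat_le_iff)
  then have "real (\<Sum>e\<in>?R. card (T e)) + real (card ?X)
      \<le> real m * real (?n choose r) + (real k + 1) * real (card D)"
    by (simp add: algebra_simps)
  then have "real (card ?X) \<le> (real k + 1) * real (card D) + C * N"
    using dense unfolding N_def by linarith
  also have "\<dots> \<le> (real k + 1) * ((K + K') * N) + C * N"
    using cD by (intro add_right_mono mult_left_mono) auto
  finally show ?thesis unfolding N_def by (simp add: algebra_simps)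
qed

text \<open>There are at most \<open>k * card V ^ 2\<close> choices of an index and a pair that
  lacks it, and each spoils at most \<open>q * card V ^ (r - 3)\<close> edges.\<close>

lemma card_light_edges:
  fixes H :: "nat \<Rightarrow> 'v set set" and S :: "'v set \<Rightarrow> nat set"
  assumes finV: "finite V" and r: "3 \<le> r" and H: "\<And>i. i \<in> {1..k} \<Longrightarrow> H i \<subseteq> nsets V r"
    and S: "\<And>p i. i \<in> {1..k} \<Longrightarrow> i \<notin> S p \<Longrightarrow> card {e \<in> H i. p \<subseteq> e} \<le> q * card V ^ (r - 3)"
  shows "card {e \<in> nsets V r. \<exists>p\<in>nsets e 2. \<exists>i\<in>{1..k}. e \<in> H i \<and> i \<notin> S p}
    \<le> k * q * card V ^ (r - 1)"
proof -
  let ?L = "{e \<in> nsets V r. \<exists>p\<in>nsets e 2. \<exists>i\<in>{1..k}. e \<in> H i \<and> i \<notin> S p}"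
  define Z where "Z = {z \<in> {1..k} \<times> nsets V 2. fst z \<notin> S (snd z)}"
  let ?U = "\<lambda>z. {e \<in> H (fst z). snd z \<subseteq> e}"
  have fin: "finite (nsets V i)" for i using finV by (rule finite_imp_finite_nsets)
  have finH: "finite (H i)" if "i \<in> {1..k}" for i using H[OF that] fin by (rule finite_subset)
  have finZ: "finite Z" unfolding Z_def using fin by simp
  have "?L \<subseteq> (\<Union>z\<in>Z. ?U z)"
  proof
    fix e assume "e \<in> ?L"
    then obtain p i where pi: "e \<in> nsets V r" "p \<in> nsets e 2" "i \<in> {1..k}" "e \<in> H i" "i \<notin> S p"
      by blast
    then have "p \<in> nsets V 2" "p \<subseteq> e" by (auto simp: nsets_def)
    then have "(i, p) \<in> Z" "e \<in> ?U (i, p)" using pi by (auto simp: Z_def)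
    then show "e \<in> (\<Union>z\<in>Z. ?U z)" by blast
  qed
  then have "card ?L \<le> card (\<Union>z\<in>Z. ?U z)"
    using finZ finH by (intro card_mono) (auto simp: Z_def)
  also have "\<dots> \<le> (\<Sum>z\<in>Z. card (?U z))" using finZ by (rule card_UN_le)
  also have "\<dots> \<le> (\<Sum>z\<in>Z. q * card V ^ (r - 3))"
    using S by (intro sum_mono) (auto simp: Z_def)
  also have "\<dots> = card Z * (q * card V ^ (r - 3))" by simp
  also have "card Z \<le> card ({1..k} \<times> nsets V 2)"
    unfolding Z_def using fin by (intro card_mono) auto
  also have "card ({1..k} \<times> nsets V 2) = k * (card V choose 2)"
    using finV by (simp add: card_cartesian_product)
  also have "\<dots> \<le> k * card V ^ 2" using binomial_le_power by (intro mult_left_mono) auto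
  also have "k * card V ^ 2 * (q * card V ^ (r - 3)) = k * q * (card V ^ 2 * card V ^ (r - 3))"
    by (simp add: mult_ac)
  also have "card V ^ 2 * card V ^ (r - 3) = card V ^ (r - 1)"
  proof -
    have "r - 1 = 2 + (r - 3)" using r by simp
    then show ?thesis by (simp only: power_add)
  qed
  finally show ?thesis by simp
qed

section \<open>Ordering the hypergraphs and assembling the proof\<close>

text \<open>Stability produces some set of \<open>m\<close> indices; only the order by size
  identifies it. A set other than \<open>{1..m}\<close> contains some \<open>i > m\<close> and
  misses some \<open>j \<le> m\<close>, so the gap contradicts monotonicity.\<close>

lemma initial_segment_of_decreasing:
  fixes h :: "nat \<Rightarrow> real"
  assumes I: "I \<subseteq> {1..k}" "card I = m" and "m \<le> k"
    and mono: "\<And>i j. i \<in> {1..k} \<Longrightarrow> j \<in> {1..k} \<Longrightarrow> i \<le> j \<Longrightarrow> h j \<le> h i"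
    and gap: "\<And>i j. i \<in> I \<Longrightarrow> j \<in> {1..k} - I \<Longrightarrow> h j < h i"
  shows "I = {1..m}"
proof (rule ccontr)
  assume ne: "I \<noteq> {1..m}"
  have finI: "finite I" using I(1) by (rule finite_subset) simp
  have "\<not> I \<subseteq> {1..m}" using card_subset_eq[of "{1..m}" I] I(2) ne by auto
  then obtain i where i: "i \<in> I" "i > m" using I(1) by fastforce
  have "\<not> {1..m} \<subseteq> I" using card_subset_eq[OF finI, of "{1..m}"] I(2) ne by auto
  then obtain j where j: "j \<in> {1..m}" "j \<notin> I" by blast
  have ik: "i \<in> {1..k}" and jk: "j \<in> {1..k}" using i I(1) j(1) \<open>m \<le> k\<close> by auto
  have "j \<le> i" using i j by simp
  then have "h i \<le> h j" using mono ik jk by blast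
  moreover have "h j < h i" using gap[OF i(1)] j(2) jk by simp
  ultimately show False by simp
qed

theorem theorem3p4:
  fixes l r k :: nat and C :: real
  assumes "3 \<le> r" and "r \<le> l"
    and "(l choose 2) - 1 \<le> k" and "real k < ((real l)\<^sup>2 - 1) / 2"
    and "C > 0"
  shows "\<exists>C'>0. \<exists>n0::nat. \<forall>n\<ge>n0. \<forall>(V :: 'v set) (H :: nat \<Rightarrow> 'v set set).
    finite V \<longrightarrow> card V = n \<longrightarrow>
    (\<forall>i\<in>{1..k}. H i \<subseteq> nsets V r) \<longrightarrow>
    \<not> contains_rainbow_copy V {1..k} H (expansion r (complete_graph l)) \<longrightarrow>
    (\<forall>i\<in>{1..k}. \<forall>j\<in>{1..k}. i \<le> j \<longrightarrow> card (H i) \<ge> card (H j)) \<longrightarrow>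
    real (\<Sum>i\<in>{1..k}. card (H i))
      \<ge> (real (l choose 2) - 1) * real (n choose r) - C * real n ^ (r - 1) \<longrightarrow>
    (\<exists>D \<subseteq> (\<Union>i\<in>{1..k}. H i).
       real (card D) \<le> C' * real n ^ (r - 1) \<and>
       (\<forall>e \<in> (\<Union>i\<in>{1..k}. H i) - D. {i\<in>{1..k}. e \<in> H i} = {1..(l choose 2) - 1}))"
proof -
  define m where "m = (l choose 2) - 1"
  \<comment> \<open>\<open>q\<close> bounds the vertices to avoid in an expansion, \<open>K\<close>
    the light edges, \<open>C2\<close> the error for the pair weights and \<open>K'\<close> the
    exceptional pairs, the last three up to powers of \<open>n\<close>.\<close>
  define q where "q = l + (l choose 2) * (r - 2)"
  define K where "K = real (k * q)"
  define C2 where "C2 = real (r choose 2) * (C + real k * K) * (2 * real r) ^ (r - 2)"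
  define K' where "K' = 2 * real l * C2"
  define C' where "C' = (real k + 1) * (K + K') + C"
  define M where "M = (real k + 1) * (real (2 * l\<^sup>2 * (k + 1) + l))\<^sup>2"
  have l: "3 \<le> l" using assms by simp
  have mk: "m \<le> k" using assms by (simp add: m_def)
  have "(l choose 2) \<ge> (3 choose 2)" using l by (rule binomial_right_mono)
  then have m1: "real (l choose 2) - 1 = real m" by (simp add: m_def choose_two)
  have "real (2 * k + 1) < real (l\<^sup>2)" using assms(4) by (simp add: field_simps)
  then have k2: "2 * k + 1 < l\<^sup>2" by (simp only: of_nat_less_iff)
  have pos: "0 \<le> K" "0 \<le> C2" "0 \<le> K'" "0 \<le> M" using assms(5) by (simp_all add: K_def C2_def K'_def M_def)
  then have C': "0 < C'" using assms(5) unfolding C'_def by (intro add_nonneg_pos) auto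
  \<comment> \<open>The first bound serves the binomial estimates, the second separates the sizes of
    the hypergraphs inside and outside \<open>I\<close>, and the third gives the size condition of
    \<open>graph_stability\<close>.\<close>
  obtain n0 :: nat where n0: "max (real r + 4) (max (2 * C' * real r ^ r) (4 * real l * (C2 + M) + 1)) < real n0"
    using reals_Archimedean2 by blast
  have main: "\<exists>D \<subseteq> (\<Union>i\<in>{1..k}. H i). real (card D) \<le> C' * real n ^ (r - 1) \<and>
       (\<forall>e \<in> (\<Union>i\<in>{1..k}. H i) - D. {i\<in>{1..k}. e \<in> H i} = {1..m})"
    if n: "n0 \<le> n" and finV: "finite V" and V: "card V = n"
      and H: "\<forall>i\<in>{1..k}. H i \<subseteq> nsets V r"
      and nr: "\<not> contains_rainbow_copy V {1..k} H (expansion r (complete_graph l))"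
      and mono: "\<forall>i\<in>{1..k}. \<forall>j\<in>{1..k}. i \<le> j \<longrightarrow> card (H i) \<ge> card (H j)"
      and dense: "real (\<Sum>i\<in>{1..k}. card (H i)) \<ge> real m * real (n choose r) - C * real n ^ (r - 1)"
    for n and V :: "'v set" and H
  proof -
    have nlarge: "real r + 4 < real n" "2 * C' * real r ^ r < real n" "4 * real l * (C2 + M) + 1 < real n"
      using n0 n by auto
    have n4: "r \<le> card V" "4 \<le> card V" using nlarge(1) V by auto
    have fin: "finite (nsets V i)" for i using finV by (rule finite_imp_finite_nsets)
    define S where "S p = {i \<in> {1..k}. q * n ^ (r - 3) < card {e \<in> H i. p \<subseteq> e}}" for p
    define T where "T e = {i \<in> {1..k}. e \<in> H i}" for e
    define L where "L = {e \<in> nsets V r. \<exists>p\<in>nsets e 2. \<exists>i\<in>{1..k}. e \<in> H i \<and> i \<notin> S p}"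
    have Sk: "S p \<subseteq> {1..k}" for p by (auto simp: S_def)
    have "T e \<subseteq> {1..k}" for e by (auto simp: T_def)
    then have Tk: "card (T e) \<le> k" for e using card_mono[of "{1..k}" "T e"] by simp
    have "card L \<le> k * q * card V ^ (r - 1)"
      unfolding L_def
    proof (rule card_light_edges[OF finV assms(1)])
      show "card {e \<in> H i. p \<subseteq> e} \<le> q * card V ^ (r - 3)" if "i \<in> {1..k}" "i \<notin> S p" for p i
        using that V by (simp add: S_def)
    qed (use H in blast)
    then have "real (card L) \<le> real (k * q * card V ^ (r - 1))" by (simp only: of_nat_le_iff)
    then have L: "real (card L) \<le> K * real (card V) ^ (r - 1)" by (simp add: K_def)
    have LR: "L \<subseteq> nsets V r" by (auto simp: L_def)
    have TS: "T e \<subseteq> S p" if "e \<in> nsets V r - L" "p \<in> nsets e 2" for e p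
      using that by (auto simp: L_def T_def)
    have "(\<Sum>e\<in>nsets V r. card (T e)) = (\<Sum>e\<in>nsets V r. \<Sum>i\<in>{1..k}. if e \<in> H i then 1 else 0)"
      by (simp add: T_def flip: sum.inter_filter)
    also have "\<dots> = (\<Sum>i\<in>{1..k}. \<Sum>e\<in>nsets V r. if e \<in> H i then 1 else 0)" by (rule sum.swap)
    also have "\<dots> = (\<Sum>i\<in>{1..k}. card (H i))"
    proof (rule sum.cong)
      fix i assume "i \<in> {1..k}"
      then have "{e \<in> nsets V r. e \<in> H i} = H i" using H by blast
      then show "(\<Sum>e\<in>nsets V r. if e \<in> H i then 1 else 0) = card (H i)"
        using fin by (simp flip: sum.inter_filter)
    qed simp
    finally have dense': "real m * real (card V choose r) - C * real (card V) ^ (r - 1)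
        \<le> real (\<Sum>e\<in>nsets V r. card (T e))" using dense V by simp
    have norain: "\<not> rainbow_clique l S V"
    proof
      assume rc: "rainbow_clique l S V"
      have "contains_rainbow_copy V {1..k} H (expansion r (complete_graph l))"
      proof (rule rainbow_expansion_of_clique[OF finV _ _ rc])
        show "i \<in> {1..k} \<and> (l + (l choose 2) * (r - 2)) * card V ^ (r - 3) < card {e \<in> H i. p \<subseteq> e}"
          if "i \<in> S p" for p i
          using that V by (simp add: S_def q_def)
      qed (use H in auto)
      then show False using nr by blast
    qed
    have shadow: "real m * real (card V choose 2) - C2 * real (card V) \<le> real (\<Sum>p\<in>nsets V 2. card (S p))"
      unfolding C2_def
      by (rule dense_shadow[OF finV _ n4(1,2) _ pos(1) Tk _ LR L TS dense'])
         (use assms(1,5) finite_subset[OF Sk] in auto)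
    have big: "M < real (card V choose 2) / (2 * real l) - C2 * real (card V)"
    proof -
      have "C2 + M < (real n - 1) / (4 * real l)"
        using nlarge(3) l by (simp add: field_simps)
      then have "real n * (C2 + M) < real n * ((real n - 1) / (4 * real l))"
        by (rule mult_strict_left_mono) (use n4 V in simp)
      also have "\<dots> = real (n choose 2) / (2 * real l)"
        using n4 V by (cases n) (auto simp: choose_two real_of_nat_div field_simps)
      finally have "real n * C2 + real n * M < real (n choose 2) / (2 * real l)"
        by (simp add: distrib_left)
      moreover have "M \<le> real n * M" using pos(4) n4 V by (simp add: mult_le_cancel_right1)
      ultimately show ?thesis using V by (simp add: mult.commute)
    qed
    have "\<exists>I\<subseteq>{1..k}. card I = m \<and>
        real (card {p \<in> nsets V 2. S p \<noteq> I}) \<le> K' * real (card V)"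
      unfolding K'_def by (rule graph_stability[OF l m_def mk k2 finV Sk norain shadow big[unfolded M_def]])
    then obtain I where "I \<subseteq> {1..k} \<and> card I = m \<and>
        real (card {p \<in> nsets V 2. S p \<noteq> I}) \<le> K' * real (card V)" ..
    then have I: "I \<subseteq> {1..k}" "card I = m"
      and few: "real (card {p \<in> nsets V 2. S p \<noteq> I}) \<le> K' * real (card V)" by simp_all
    have finI: "finite I" using I(1) by (rule finite_subset) simp
    have bad: "real (card {e \<in> nsets V r. T e \<noteq> I}) \<le> C' * real n ^ (r - 1)"
      using uniform_edges[OF finV _ Tk finI I(2) LR L TS few dense'] assms(1) V
      by (simp add: C'_def)
    let ?X = "{e \<in> nsets V r. T e \<noteq> I}"
    have finX: "finite ?X" using fin by simp
    \<comment> \<open>For \<open>i \<in> I\<close> the hypergraph \<open>H i\<close> misses at most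
      \<open>C' * n ^ (r - 1)\<close> of all \<open>r\<close>-sets, and for \<open>j\<close> outside
      \<open>I\<close> it has at most that many edges; this inequality keeps the two ranges
      apart.\<close>
    have "2 * (C' * real n ^ (r - 1)) < real (n choose r)"
    proof -
      have rp: "0 < real r" using assms(1) by simp
      have "2 * C' * real r ^ r * real n ^ (r - 1) < real n * real n ^ (r - 1)"
        using nlarge(2) n4 V by simp
      also have "\<dots> = real n ^ r" using assms(1) by (cases r) auto
      finally have "2 * (C' * real n ^ (r - 1)) < (real n / real r) ^ r"
        using rp by (simp add: power_divide field_simps)
      also have "\<dots> \<le> real (n choose r)" using n4 V by (intro binomial_ge_n_over_k_pow_k) simp
      finally show ?thesis .
    qed
    moreover have "real (card (H j)) \<le> C' * real n ^ (r - 1)" if "j \<in> {1..k} - I" for j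
    proof -
      have "H j \<subseteq> ?X" using that H by (auto simp: T_def)
      then have "card (H j) \<le> card ?X" using finX by (rule card_mono[rotated])
      then show ?thesis using bad by linarith
    qed
    moreover have "real (n choose r) - C' * real n ^ (r - 1) \<le> real (card (H i))" if "i \<in> I" for i
    proof -
      have "nsets V r \<subseteq> H i \<union> ?X" using that by (auto simp: T_def)
      moreover have "finite (H i)" using H that I(1) fin finite_subset by blast
      ultimately have "card (nsets V r) \<le> card (H i \<union> ?X)" using finX by (intro card_mono) auto
      also have "\<dots> \<le> card (H i) + card ?X" by (rule card_Un_le)
      finally show ?thesis using bad finV V by (simp)
    qed
    ultimately have gap: "real (card (H j)) < real (card (H i))" if "i \<in> I" "j \<in> {1..k} - I" for i j
      using that by fastforce
    have Im: "I = {1..m}"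
      by (rule initial_segment_of_decreasing[OF I mk _ gap]) (use mono in auto)
    let ?D = "{e \<in> (\<Union>i\<in>{1..k}. H i). T e \<noteq> {1..m}}"
    have "?D \<subseteq> ?X" using H Im by blast
    then have "card ?D \<le> card ?X" using finX by (rule card_mono[rotated])
    then have "real (card ?D) \<le> C' * real n ^ (r - 1)" using bad by linarith
    then show ?thesis by (intro exI[of _ ?D]) (auto simp: T_def)
  qed
  show ?thesis
    unfolding m_def[symmetric] m1
    by (intro exI[of _ C'] exI[of _ n0] conjI C' allI impI) (rule main)
qed

end
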